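(* Let $\sigma\in\mathsf S_\ell$ be a $3\,2\,1$-avoiding permutation, and let $\Psi(\sigma)=(S^+,S^-)$ be the pair of tableaux constructed from path depth differences (see context). Suppose $\sigma$ corresponds to $(R,Q)$ under the Robinson–Schensted correspondence, where $R$ is the recording tableau and $Q$ is the insertion tableau. Then $S^+=R$ and $S^-=Q$.
   Context: A permutation $\sigma\in\mathsf S_\ell$ is $3\,2\,1$-avoiding if there are no $1\le a<b<c\le\ell$ with $\sigma(c)<\sigma(b)<\sigma(a)$. Robinson–Schensted: $Q$ is obtained by row-inserting $\sigma(1),\sigma(2),\dots,\sigma(\ell)$ successively, and $R$ records the position of the box added at each step. Diagram of $\sigma$: vertices $t_1,\dots,t_\ell$ from left to right on a top boundary line and $b_1,\dots,b_\ell$ from left to right on a bottom boundary line, with $t_i$ joined to $b_{\sigma(i)}$ by a line (two lines cross at most once, exactly when they form an inversion). The lines divide the region between the two boundary lines into faces; $f_\infty$ is the unbounded face open to the left. For a point $x$ in the interior of a face $f$, the path depth $d_\sigma(f)$ is the minimal number of edges crossed by any path from $x$ to $f_\infty$ that does not intersect the top or bottom boundary; a path crossing horizontally through the intersection point of two lines is counted as making a single edge crossing there. For a boundary vertex $v$, put $\delta_\sigma(v)=d_\sigma(f_v^r)-d_\sigma(f_v^l)$, where $f_v^l$ and $f_v^r$ are the faces immediately to the left and to the right of $v$. This is always $0$ or $1$. $\Psi(\sigma)=(S^+,S^-)$: for $i=1,\dots,\ell$, put $i$ in the first row of $S^+$ if $\delta_\sigma(t_i)=1$ and in the second row of $S^+$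 if $\delta_\sigma(t_i)=0$; put $i$ in the first row of $S^-$ if $\delta_\sigma(b_i)=1$ and in the second row of $S^-$ if $\delta_\sigma(b_i)=0$. Rows are arranged in increasing order. *)

theory Defs
  imports
    "HOL-Analysis.Analysis"
    "HOL-Combinatorics.Permutations"
    "HOL-Library.More_List"
begin

text \<open>Permutations of size \<open>l\<close> are functions \<open>\<sigma>\<close> with \<open>\<sigma> permutes {1..l}\<close>.\<close>

definition avoids_321 :: "nat \<Rightarrow> (nat \<Rightarrow> nat) \<Rightarrow> bool" where
  "avoids_321 l \<sigma> \<longleftrightarrow>
     \<not> (\<exists>a b c. 1 \<le> a \<and> a < b \<and> b < c \<and> c \<le> l \<and> \<sigma> c < \<sigma> b \<and> \<sigma> b < \<sigma> a)"


section \<open>Robinson--Schensted\<close>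

text \<open>A tableau is the list of its nonempty rows, from top to bottom.\<close>

type_synonym tableau = "nat list list"

text \<open>The new row together with the bumped entry, if any.\<close>

fun row_insert :: "nat \<Rightarrow> nat list \<Rightarrow> nat list \<times> nat option" where
  "row_insert x [] = ([x], None)"
| "row_insert x (y # ys) =
     (if x < y then (x # ys, Some y)
      else (case row_insert x ys of (zs, b) \<Rightarrow> (y # zs, b)))"

text \<open>The new tableau together with the index (from 0) of the row that gained a box.\<close>

fun tableau_insert :: "nat \<Rightarrow> tableau \<Rightarrow> tableau \<times> nat" where
  "tableau_insert x [] = ([[x]], 0)"
| "tableau_insert x (r # rs) =
     (case row_insert x r of
        (r', None) \<Rightarrow> (r' # rs, 0)
      | (r', Some y) \<Rightarrow> (case tableau_insert y rs of (rs', k) \<Rightarrow> (r' # rs', Suc k)))"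

definition add_box :: "nat \<Rightarrow> nat \<Rightarrow> tableau \<Rightarrow> tableau" where
  "add_box k x T = (if k < length T then T[k := T ! k @ [x]] else T @ [[x]])"

text \<open>Pairs are (recording tableau, insertion tableau), in this order.\<close>

definition rs_step :: "(nat \<Rightarrow> nat) \<Rightarrow> nat \<Rightarrow> tableau \<times> tableau \<Rightarrow> tableau \<times> tableau" where
  "rs_step \<sigma> i = (\<lambda>(R, Q). case tableau_insert (\<sigma> i) Q of (Q', k) \<Rightarrow> (add_box k i R, Q'))"

definition robinson_schensted :: "nat \<Rightarrow> (nat \<Rightarrow> nat) \<Rightarrow> tableau \<times> tableau" where
  "robinson_schensted l \<sigma> = fold (rs_step \<sigma>) [1..<Suc l] ([], [])"


section \<open>The diagram of a permutation\<close>

definition top_vertex :: "nat \<Rightarrow> real \<times> real" where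
  "top_vertex i = (real i, 1)"

definition bottom_vertex :: "nat \<Rightarrow> real \<times> real" where
  "bottom_vertex i = (real i, 0)"

definition strand :: "(nat \<Rightarrow> nat) \<Rightarrow> nat \<Rightarrow> (real \<times> real) set" where
  "strand \<sigma> i = closed_segment (top_vertex i) (bottom_vertex (\<sigma> i))"

definition strands :: "nat \<Rightarrow> (nat \<Rightarrow> nat) \<Rightarrow> (real \<times> real) set" where
  "strands l \<sigma> = (\<Union>i\<in>{1..l}. strand \<sigma> i)"

definition strip :: "(real \<times> real) set" where
  "strip = {(x, y). 0 < y \<and> y < 1}"

definition faces :: "nat \<Rightarrow> (nat \<Rightarrow> nat) \<Rightarrow> (real \<times> real) set set" where
  "faces l \<sigma> = components (strip - strands l \<sigma>)"

definition face_infinity :: "nat \<Rightarrow> (nat \<Rightarrow> nat) \<Rightarrow> (real \<times> real) set" where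
  "face_infinity l \<sigma> =
     (THE F. F \<in> faces l \<sigma> \<and> (\<exists>c. \<forall>x y. x < c \<and> 0 < y \<and> y < 1 \<longrightarrow> (x, y) \<in> F))"

text \<open>For a vertex \<open>v\<close> on the boundary of the strip, the faces immediately to its left and right
  are those whose closure contains the boundary points just to the left and right of \<open>v\<close>.\<close>

definition face_left :: "nat \<Rightarrow> (nat \<Rightarrow> nat) \<Rightarrow> real \<times> real \<Rightarrow> (real \<times> real) set" where
  "face_left l \<sigma> v =
     (THE F. F \<in> faces l \<sigma> \<and> (\<exists>e>0. \<forall>s. 0 < s \<and> s < e \<longrightarrow> v - (s, 0) \<in> closure F))"

definition face_right :: "nat \<Rightarrow> (nat \<Rightarrow> nat) \<Rightarrow> real \<times> real \<Rightarrow> (real \<times> real) set" where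
  "face_right l \<sigma> v =
     (THE F. F \<in> faces l \<sigma> \<and> (\<exists>e>0. \<forall>s. 0 < s \<and> s < e \<longrightarrow> v + (s, 0) \<in> closure F))"


section \<open>Path depth\<close>

definition left_of :: "(nat \<Rightarrow> nat) \<Rightarrow> nat \<Rightarrow> real \<times> real \<Rightarrow> bool" where
  "left_of \<sigma> i p \<longleftrightarrow> (\<exists>s>0. p + (s, 0) \<in> strand \<sigma> i)"

definition right_of :: "(nat \<Rightarrow> nat) \<Rightarrow> nat \<Rightarrow> real \<times> real \<Rightarrow> bool" where
  "right_of \<sigma> i p \<longleftrightarrow> (\<exists>s>0. p - (s, 0) \<in> strand \<sigma> i)"

definition crosses_leftward ::
    "(nat \<Rightarrow> nat) \<Rightarrow> (real \<Rightarrow> real \<times> real) \<Rightarrow> real \<Rightarrow> nat \<Rightarrow> bool" where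
  "crosses_leftward \<sigma> \<gamma> t i \<longleftrightarrow> \<gamma> t \<in> strand \<sigma> i \<and>
     (\<forall>\<^sub>F s in at_left t. right_of \<sigma> i (\<gamma> s)) \<and> (\<forall>\<^sub>F s in at_right t. left_of \<sigma> i (\<gamma> s))"

definition crosses_rightward ::
    "(nat \<Rightarrow> nat) \<Rightarrow> (real \<Rightarrow> real \<times> real) \<Rightarrow> real \<Rightarrow> nat \<Rightarrow> bool" where
  "crosses_rightward \<sigma> \<gamma> t i \<longleftrightarrow> \<gamma> t \<in> strand \<sigma> i \<and>
     (\<forall>\<^sub>F s in at_left t. left_of \<sigma> i (\<gamma> s)) \<and> (\<forall>\<^sub>F s in at_right t. right_of \<sigma> i (\<gamma> s))"

text \<open>The path passes through an intersection point of two lines from the face on its left to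
  the face on its right or conversely: both lines are crossed in the same direction. Passing
  vertically, from the face above to the face below, crosses them in opposite directions.\<close>

definition crosses_horizontally ::
    "nat \<Rightarrow> (nat \<Rightarrow> nat) \<Rightarrow> (real \<Rightarrow> real \<times> real) \<Rightarrow> real \<Rightarrow> bool" where
  "crosses_horizontally l \<sigma> \<gamma> t \<longleftrightarrow> (\<exists>i\<in>{1..l}. \<exists>j\<in>{1..l}. i \<noteq> j \<and>
     (crosses_leftward \<sigma> \<gamma> t i \<and> crosses_leftward \<sigma> \<gamma> t j \<or>
      crosses_rightward \<sigma> \<gamma> t i \<and> crosses_rightward \<sigma> \<gamma> t j))"

definition crossings_at ::
    "nat \<Rightarrow> (nat \<Rightarrow> nat) \<Rightarrow> (real \<Rightarrow> real \<times> real) \<Rightarrow> real \<Rightarrow> nat" where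
  "crossings_at l \<sigma> \<gamma> t =
     (if crosses_horizontally l \<sigma> \<gamma> t then 1
      else card {i \<in> {1..l}. crosses_leftward \<sigma> \<gamma> t i \<or> crosses_rightward \<sigma> \<gamma> t i})"

definition meeting_times ::
    "nat \<Rightarrow> (nat \<Rightarrow> nat) \<Rightarrow> (real \<Rightarrow> real \<times> real) \<Rightarrow> real set" where
  "meeting_times l \<sigma> \<gamma> = {t \<in> {0..1}. \<gamma> t \<in> strands l \<sigma>}"

definition path_crossings ::
    "nat \<Rightarrow> (nat \<Rightarrow> nat) \<Rightarrow> (real \<Rightarrow> real \<times> real) \<Rightarrow> nat" where
  "path_crossings l \<sigma> \<gamma> = (\<Sum>t\<in>meeting_times l \<sigma> \<gamma>. crossings_at l \<sigma> \<gamma> t)"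

text \<open>Only paths meeting the lines finitely often have a well-defined number of crossings; in
  particular a path may not run along an edge.\<close>

definition escape_path ::
    "nat \<Rightarrow> (nat \<Rightarrow> nat) \<Rightarrow> (real \<times> real) set \<Rightarrow> (real \<Rightarrow> real \<times> real) \<Rightarrow> bool" where
  "escape_path l \<sigma> F \<gamma> \<longleftrightarrow> path \<gamma> \<and> path_image \<gamma> \<subseteq> strip \<and>
     pathstart \<gamma> \<in> F \<and> pathfinish \<gamma> \<in> face_infinity l \<sigma> \<and> finite (meeting_times l \<sigma> \<gamma>)"

text \<open>The starting point may be any point of the (open, connected) face: moving it inside the
  face crosses no edge.\<close>

definition path_depth :: "nat \<Rightarrow> (nat \<Rightarrow> nat) \<Rightarrow> (real \<times> real) set \<Rightarrow> nat" where
  "path_depth l \<sigma> F = (LEAST n. \<exists>\<gamma>. escape_path l \<sigma> F \<gamma> \<and> path_crossings l \<sigma> \<gamma> = n)"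

definition depth_diff :: "nat \<Rightarrow> (nat \<Rightarrow> nat) \<Rightarrow> real \<times> real \<Rightarrow> int" where
  "depth_diff l \<sigma> v =
     int (path_depth l \<sigma> (face_right l \<sigma> v)) - int (path_depth l \<sigma> (face_left l \<sigma> v))"

text \<open>Trailing empty rows are dropped, since a tableau lists nonempty rows only.\<close>

definition two_row_tableau :: "nat \<Rightarrow> (nat \<Rightarrow> int) \<Rightarrow> tableau" where
  "two_row_tableau l \<delta> = strip_while (\<lambda>r. r = [])
     [filter (\<lambda>i. \<delta> i = 1) [1..<Suc l], filter (\<lambda>i. \<delta> i = 0) [1..<Suc l]]"

definition Psi :: "nat \<Rightarrow> (nat \<Rightarrow> nat) \<Rightarrow> tableau \<times> tableau" where
  "Psi l \<sigma> =
     (two_row_tableau l (\<lambda>i. depth_diff l \<sigma> (top_vertex i)),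
      two_row_tableau l (\<lambda>i. depth_diff l \<sigma> (bottom_vertex i)))"

end

theory Submission
  imports Defs
begin

text \<open>
  Both sides are governed by longest increasing subsequences. Two strands \<open>i < j\<close> cross exactly
  when they form an inversion, so an increasing subsequence of \<open>\<sigma>\<close> is a family of pairwise
  non-crossing strands; \<open>lis \<sigma> S\<close> is the largest size of such a family inside \<open>S\<close>.

  On the geometric side, a face is determined by the set \<open>S\<close> of strands to its left, and its path
  depth is \<open>lis \<sigma> S\<close> (\<open>path_depth_sector\<close>). A path cannot do better: at any instant the strands
  that it crosses pass through one point, hence cross pairwise, so at most one of them lies in a given
  non-crossing family, while the instant contributes at least one crossing
  (\<open>lis_le_path_crossings\<close>). Conversely, the maximal strands in \<open>S\<close> for the order ``entirely to the
  left of'' pairwise cross, so there are at most two of them because \<open>\<sigma>\<close> avoids 321. They bound the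
  face on the left, and if there are two, no strand can separate the face from their intersection
  point, for it would have to cross both. Hence one crossing, of an edge or horizontally through an
  intersection point, removes all maximal strands, which lowers \<open>lis\<close> by one
  (\<open>rightmost_exit_point\<close>, \<open>lis_remove_rightmost\<close>).

  The strands to the left of a point of the top boundary form an initial segment of positions, and
  those to the left of a point of the bottom boundary are the ones with the smallest values. So the
  depth difference at \<open>t\<^sub>i\<close> tells whether the prefix of length \<open>i\<close> has a longer increasing subsequence
  than the prefix of length \<open>i - 1\<close>, and the one at \<open>b\<^sub>v\<close> tells the same about the subwords of
  values at most \<open>v\<close> and less than \<open>v\<close>.

  On the Robinson--Schensted side, a form of Schensted's theorem with a bound on the values
  (contained in \<open>rs_invariant\<close>) says that the number of entries at most \<open>v\<close> in the first row is the
  length of the longest increasing subsequence with values at most \<open>v\<close>. Letting \<open>v\<close> be large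
  describes when the first row grows, which is the recording tableau; letting \<open>v\<close> vary at the end
  describes which values are in the first row of the insertion tableau. The entries bumped out of
  the first row come in increasing order since \<open>\<sigma>\<close> avoids 321, so nothing is bumped from the
  second row and the second row is simply the complement of the first.
\<close>

section \<open>Longest increasing subsequences\<close>

text \<open>The subsequence is given by its set of positions: for the diagram the positions are strands, and
  the positions left of a face need not be consecutive.\<close>

definition lis :: "(nat \<Rightarrow> nat) \<Rightarrow> nat set \<Rightarrow> nat" where
  "lis \<sigma> S = Max (card ` {C. C \<subseteq> S \<and> strict_mono_on C \<sigma>})"

lemma card_le_lis:
  assumes "finite S" "C \<subseteq> S" "strict_mono_on C \<sigma>"
  shows "card C \<le> lis \<sigma> S"
  unfolding lis_def using assms by (intro Max_ge) auto

lemma lis_attained: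
  assumes "finite S"
  obtains C where "C \<subseteq> S" "strict_mono_on C \<sigma>" "card C = lis \<sigma> S"
proof -
  have "lis \<sigma> S \<in> card ` {C. C \<subseteq> S \<and> strict_mono_on C \<sigma>}"
    unfolding lis_def
  proof (rule Max_in)
    show "finite (card ` {C. C \<subseteq> S \<and> strict_mono_on C \<sigma>})" using assms by simp
    have "{} \<in> {C. C \<subseteq> S \<and> strict_mono_on C \<sigma>}" by (simp add: monotone_on_def)
    then show "card ` {C. C \<subseteq> S \<and> strict_mono_on C \<sigma>} \<noteq> {}" by blast
  qed
  then show thesis using that by auto
qed

lemma lis_mono:
  assumes "finite T" "S \<subseteq> T"
  shows "lis \<sigma> S \<le> lis \<sigma> T"
proof -
  obtain C where "C \<subseteq> S" "strict_mono_on C \<sigma>" "card C = lis \<sigma> S"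
    using lis_attained finite_subset[OF assms(2,1)] by blast
  then show ?thesis using card_le_lis[OF assms(1), of C \<sigma>] assms(2) by auto
qed

lemma lis_empty [simp]: "lis \<sigma> {} = 0"
  using lis_attained[of "{}" \<sigma>] by (metis card.empty finite.emptyI subset_empty)

lemma lis_le_lis_add:
  assumes "finite S" "finite T"
    and "\<And>C. C \<subseteq> S \<Longrightarrow> strict_mono_on C \<sigma> \<Longrightarrow> card (C - T) \<le> k"
  shows "lis \<sigma> S \<le> lis \<sigma> T + k"
proof -
  obtain C where C: "C \<subseteq> S" "strict_mono_on C \<sigma>" "card C = lis \<sigma> S"
    using lis_attained assms(1) by blast
  have "finite C" using C(1) assms(1) finite_subset by blast
  have "strict_mono_on (C \<inter> T) \<sigma>" using C(2) by (auto simp: monotone_on_def)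
  then have "card (C \<inter> T) \<le> lis \<sigma> T" by (intro card_le_lis assms(2)) auto
  moreover have "card C = card (C \<inter> T) + card (C - T)"
    by (simp add: \<open>finite C\<close> card_Int_Diff)
  ultimately show ?thesis using assms(3)[OF C(1,2)] C(3) by linarith
qed

text \<open>An increasing subsequence that uses the last position \<open>n\<close> consists otherwise of values below
  \<open>\<sigma> n\<close>.\<close>

lemma lis_append_position:
  assumes "finite S" and last: "\<And>j. j \<in> S \<Longrightarrow> j < n"
  shows "lis \<sigma> (insert n S) = max (lis \<sigma> S) (Suc (lis \<sigma> {j \<in> S. \<sigma> j < \<sigma> n}))"
proof (rule antisym)
  let ?B = "{j \<in> S. \<sigma> j < \<sigma> n}"
  have n: "n \<notin> S" using last by blast
  obtain C where C: "C \<subseteq> insert n S" "strict_mono_on C \<sigma>" "card C = lis \<sigma> (insert n S)"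
    using lis_attained[of "insert n S" \<sigma>] assms(1) by auto
  show "lis \<sigma> (insert n S) \<le> max (lis \<sigma> S) (Suc (lis \<sigma> ?B))"
  proof (cases "n \<in> C")
    case True
    have "\<sigma> j < \<sigma> n" if "j \<in> C" "j \<noteq> n" for j
      using C(1,2) True last[of j] that unfolding monotone_on_def by blast
    then have "C - {n} \<subseteq> ?B" using C(1) by blast
    moreover have "strict_mono_on (C - {n}) \<sigma>" using C(2) by (auto simp: monotone_on_def)
    ultimately have "card (C - {n}) \<le> lis \<sigma> ?B" using assms(1) by (intro card_le_lis) auto
    moreover have "card C = Suc (card (C - {n}))"
      using True C(1) assms(1) finite_subset 
      by (metis card.remove finite_insert)
    ultimately show ?thesis using C(3) by simp
  next
    case False
    then have "C \<subseteq> S" using C(1) by blast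
    then show ?thesis using card_le_lis[OF assms(1) _ C(2)] C(3) by simp
  qed
  obtain D where D: "D \<subseteq> ?B" "strict_mono_on D \<sigma>" "card D = lis \<sigma> ?B"
    using lis_attained[of ?B \<sigma>] assms(1) by auto
  have nD: "n \<notin> D" "finite D" using D(1) n assms(1) finite_subset[of D S] by auto
  have "strict_mono_on (insert n D) \<sigma>"
    unfolding monotone_on_def
  proof (intro ballI impI)
    fix i j assume "i \<in> insert n D" "j \<in> insert n D" "i < j"
    moreover have "k < n \<and> \<sigma> k < \<sigma> n" if "k \<in> D" for k using D(1) last[of k] that by blast
    ultimately show "\<sigma> i < \<sigma> j" using D(2) unfolding monotone_on_def
      by (metis insertE less_asym less_irrefl)
  qed
  then have "card (insert n D) \<le> lis \<sigma> (insert n S)"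
    using D(1) assms(1) by (intro card_le_lis) auto
  then show "max (lis \<sigma> S) (Suc (lis \<sigma> ?B)) \<le> lis \<sigma> (insert n S)"
    using D(3) nD lis_mono[of "insert n S" S \<sigma>] assms(1) by auto
qed

section \<open>Insertion of a 321-avoiding permutation\<close>

lemma row_insert_None:
  "row_insert x A = (A', None) \<Longrightarrow> A' = A @ [x] \<and> (\<forall>a\<in>set A. a \<le> x)"
  by (induction A arbitrary: A') (auto split: if_splits prod.splits)

lemma row_insert_at_end:
  "\<forall>a\<in>set A. a < x \<Longrightarrow> row_insert x A = (A @ [x], None)"
  by (induction A) auto

lemma row_insert_Some:
  assumes "row_insert x A = (A', Some y)" "sorted_wrt (<) A" "x \<notin> set A"
  shows "y \<in> set A \<and> x < y \<and> (\<forall>a\<in>set A. x < a \<longrightarrow> y \<le> a) \<and>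
    set A' = insert x (set A - {y}) \<and> sorted_wrt (<) A'"
  using assms
proof (induction A arbitrary: A')
  case (Cons a A)
  show ?case
  proof (cases "x < a")
    case True
    then show ?thesis using Cons.prems by (fastforce)
  next
    case False
    with Cons.prems obtain A1 where A1: "row_insert x A = (A1, Some y)" "A' = a # A1"
      by (auto split: prod.splits)
    then have "y \<in> set A \<and> x < y \<and> (\<forall>a\<in>set A. x < a \<longrightarrow> y \<le> a) \<and>
      set A1 = insert x (set A - {y}) \<and> sorted_wrt (<) A1"
      using Cons.IH[of A1] Cons.prems by simp
    moreover have "a < x" using False Cons.prems by auto
    ultimately show ?thesis using A1 Cons.prems by auto
  qed
qed simp

text \<open>Like \<^const>\<open>two_row_tableau\<close>, this drops empty rows, so that the insertion rules below need
  no case distinction on which rows are present.\<close>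

abbreviation two_rows :: "nat list \<Rightarrow> nat list \<Rightarrow> tableau" where
  "two_rows A B \<equiv> strip_while (\<lambda>r. r = []) [A, B]"

lemma two_rows_eq:
  "two_rows A B = (if B = [] then if A = [] then [] else [A] else [A, B])"
  by (simp add: strip_while_def)

lemma tableau_insert_append:
  assumes "row_insert x A = (A', None)" "A = [] \<Longrightarrow> B = []"
  shows "tableau_insert x (two_rows A B) = (two_rows A' B, 0)"
  using assms row_insert_None[OF assms(1)] by (auto simp: two_rows_eq)

lemma tableau_insert_bump:
  assumes "row_insert x A = (A', Some y)" "\<forall>b\<in>set B. b < y" 
  shows "tableau_insert x (two_rows A B) = (two_rows A' (B @ [y]), 1)"
proof -
  have "A \<noteq> []" using assms(1) by auto
  moreover have "row_insert y B = (B @ [y], None)" by (rule row_insert_at_end[OF assms(2)])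
  ultimately show ?thesis using assms(1) by (auto simp: two_rows_eq)
qed

lemma add_box_first_row:
  "(A = [] \<Longrightarrow> B = []) \<Longrightarrow> add_box 0 i (two_rows A B) = two_rows (A @ [i]) B"
  by (auto simp: two_rows_eq add_box_def)

lemma add_box_second_row:
  "A \<noteq> [] \<Longrightarrow> add_box 1 i (two_rows A B) = two_rows A (B @ [i])"
  by (auto simp: two_rows_eq add_box_def)

text \<open>The common value of the two constructions at a top vertex: the depth difference there, and whether
  the recording tableau places \<open>i\<close> in its first row.\<close>

definition prefix_growth :: "(nat \<Rightarrow> nat) \<Rightarrow> nat \<Rightarrow> int" where
  "prefix_growth \<sigma> i = int (lis \<sigma> {1..i}) - int (lis \<sigma> {1..<i})"

text \<open>The analogue for bottom vertices and for the entries of the insertion tableau.\<close>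

definition value_growth :: "nat \<Rightarrow> (nat \<Rightarrow> nat) \<Rightarrow> nat \<Rightarrow> int" where
  "value_growth l \<sigma> v =
     int (lis \<sigma> {j\<in>{1..l}. \<sigma> j \<le> v}) - int (lis \<sigma> {j\<in>{1..l}. \<sigma> j < v})"

lemma two_row_tableau_Suc:
  "two_row_tableau (Suc i) \<delta> =
     two_rows (filter (\<lambda>j. \<delta> j = 1) [1..<Suc i] @ (if \<delta> (Suc i) = 1 then [Suc i] else []))
              (filter (\<lambda>j. \<delta> j = 0) [1..<Suc i] @ (if \<delta> (Suc i) = 0 then [Suc i] else []))"
  by (simp add: two_row_tableau_def)

lemma first_row_nonempty:
  assumes "1 \<le> i"
  shows "filter (\<lambda>j. prefix_growth \<sigma> j = 1) [1..<Suc i] \<noteq> []"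
proof -
  have "lis \<sigma> (insert 1 {}) = 1" by (subst lis_append_position) auto
  then have "prefix_growth \<sigma> 1 = 1" by (simp add: prefix_growth_def)
  moreover have "1 \<in> set [1..<Suc i]" using assms by auto
  ultimately show ?thesis by (metis (mono_tags, lifting) filter_empty_conv)
qed

locale avoiding_permutation =
  fixes l :: nat and \<sigma> :: "nat \<Rightarrow> nat"
  assumes permutes: "\<sigma> permutes {1..l}" and avoids: "avoids_321 l \<sigma>"
begin

lemma inj: "\<sigma> i = \<sigma> j \<longleftrightarrow> i = j"
  using permutes by (auto simp: permutes_inj inj_eq)

lemma no_321:
  assumes "1 \<le> a" "a < b" "b < c" "c \<le> l" "\<sigma> c < \<sigma> b" "\<sigma> b < \<sigma> a"
  shows False
  using assms avoids unfolding avoids_321_def by blast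

text \<open>The state of the insertion tableau with rows \<open>A\<close> and \<open>B\<close> after \<open>i\<close> steps. The cardinality clause is
  Schensted's theorem for every bound \<open>v\<close> on the values. The last clause prepares the next bump: an
  entry \<open>y\<close> of the first row that is smaller than an entry \<open>z\<close> of the second row comes with a
  descent, \<open>z\<close> followed by a smaller value that is at least \<open>y\<close>. If a smaller value bumped \<open>y\<close>, that descent
  would extend to a 321 pattern.\<close>

definition rs_invariant :: "nat \<Rightarrow> nat list \<Rightarrow> nat list \<Rightarrow> bool" where
  "rs_invariant i A B \<longleftrightarrow>
     sorted_wrt (<) A \<and> sorted_wrt (<) B \<and> set A \<inter> set B = {} \<and> set A \<union> set B = \<sigma> ` {1..i} \<and>
     (\<forall>v. card {a \<in> set A. a \<le> v} = lis \<sigma> {j \<in> {1..i}. \<sigma> j \<le> v}) \<and>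
     (\<forall>z\<in>set B. \<forall>y\<in>set A. y < z \<longrightarrow>
       (\<exists>a b. 1 \<le> a \<and> a < b \<and> b \<le> i \<and> \<sigma> a = z \<and> y \<le> \<sigma> b \<and> \<sigma> b < z))"

lemma next_value_not_in_rows:
  assumes "rs_invariant i A B"
  shows "\<sigma> (Suc i) \<notin> set A \<union> set B"
proof -
  have "\<sigma> (Suc i) \<notin> \<sigma> ` {1..i}" using inj by auto
  then show ?thesis using assms unfolding rs_invariant_def by simp
qed

lemma lis_values_below_Suc:
  "lis \<sigma> {j \<in> {1..Suc i}. \<sigma> j \<le> v} =
     (if v < \<sigma> (Suc i) then lis \<sigma> {j \<in> {1..i}. \<sigma> j \<le> v}
      else max (lis \<sigma> {j \<in> {1..i}. \<sigma> j \<le> v})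
               (Suc (lis \<sigma> {j \<in> {1..i}. \<sigma> j \<le> \<sigma> (Suc i)})))"
proof (cases "v < \<sigma> (Suc i)")
  case True
  then have "{j \<in> {1..Suc i}. \<sigma> j \<le> v} = {j \<in> {1..i}. \<sigma> j \<le> v}"
    by (auto simp: le_Suc_eq)
  then show ?thesis using True by simp
next
  case False
  have 1: "{j \<in> {1..Suc i}. \<sigma> j \<le> v} = insert (Suc i) {j \<in> {1..i}. \<sigma> j \<le> v}"
    using False by (auto simp: le_Suc_eq)
  have 2: "{j \<in> {j \<in> {1..i}. \<sigma> j \<le> v}. \<sigma> j < \<sigma> (Suc i)} = {j \<in> {1..i}. \<sigma> j \<le> \<sigma> (Suc i)}"
    using False inj by (auto simp: le_less)
  show ?thesis using lis_append_position[of "{j \<in> {1..i}. \<sigma> j \<le> v}" "Suc i" \<sigma>] False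
    unfolding 1 2 by simp
qed

lemma rs_invariant_append:
  assumes inv: "rs_invariant i A B" and "Suc i \<le> l"
    and ins: "row_insert (\<sigma> (Suc i)) A = (A', None)"
  shows "rs_invariant (Suc i) A' B"
proof -
  let ?x = "\<sigma> (Suc i)"
  have x: "?x \<notin> set A" "?x \<notin> set B" using next_value_not_in_rows[OF inv] by simp_all
  have A': "A' = A @ [?x]" "\<forall>a\<in>set A. a < ?x"
    using row_insert_None[OF ins] x by (auto simp: le_less)
  have card: "card {a \<in> set A. a \<le> v} = lis \<sigma> {j \<in> {1..i}. \<sigma> j \<le> v}" for v
    using inv unfolding rs_invariant_def by blast
  have "card {a \<in> set A'. a \<le> v} = lis \<sigma> {j \<in> {1..Suc i}. \<sigma> j \<le> v}" for v
  proof (cases "v < ?x")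
    case True
    then have "{a \<in> set A'. a \<le> v} = {a \<in> set A. a \<le> v}" using A' by auto
    then show ?thesis using True card lis_values_below_Suc by simp
  next
    case False
    have "{a \<in> set A. a \<le> v} = set A" "{a \<in> set A. a \<le> ?x} = set A"
      using A' False by (auto intro: less_imp_le)
    moreover have "{a \<in> set A'. a \<le> v} = insert ?x (set A)" using A' False by auto
    ultimately show ?thesis
      using False card[of v] card[of ?x] lis_values_below_Suc x by simp
  qed
  moreover have "\<exists>a b. 1 \<le> a \<and> a < b \<and> b \<le> Suc i \<and> \<sigma> a = z \<and> y \<le> \<sigma> b \<and> \<sigma> b < z"
    if "z \<in> set B" "y \<in> set A'" "y < z" for z y
  proof (cases "y = ?x")
    case True
    have "z \<in> \<sigma> ` {1..i}" using inv that unfolding rs_invariant_def by blast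
    then obtain a where "a \<in> {1..i}" "\<sigma> a = z" by blast
    then show ?thesis using True that by (intro exI[of _ a] exI[of _ "Suc i"]) auto
  next
    case False
    then have "y \<in> set A" using that A' by auto
    then show ?thesis using inv that unfolding rs_invariant_def by (meson le_SucI)
  qed
  moreover have "set A' \<union> set B = \<sigma> ` {1..Suc i}"
    using A' inv unfolding rs_invariant_def by (auto simp: atLeastAtMostSuc_conv)
  ultimately show ?thesis using inv A' x unfolding rs_invariant_def
    by (auto simp: sorted_wrt_append)
qed

text \<open>This keeps the tableau in two rows and its second row increasing.\<close>

lemma bumped_exceeds_second_row:
  assumes inv: "rs_invariant i A B" and "Suc i \<le> l"
    and ins: "row_insert (\<sigma> (Suc i)) A = (A', Some y)"
  shows "\<forall>z\<in>set B. z < y"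
proof (rule ccontr)
  let ?x = "\<sigma> (Suc i)"
  have x: "?x \<notin> set A" using next_value_not_in_rows[OF inv] by simp
  have y: "y \<in> set A" "?x < y"
    using row_insert_Some[OF ins _ x] inv unfolding rs_invariant_def by auto
  assume "\<not> (\<forall>z\<in>set B. z < y)"
  then obtain z where z: "z \<in> set B" "y < z"
    using y(1) inv unfolding rs_invariant_def by (metis disjoint_iff linorder_neqE_nat)
  then obtain a b where "1 \<le> a" "a < b" "b \<le> i" "\<sigma> a = z" "y \<le> \<sigma> b" "\<sigma> b < z"
    using inv y(1) unfolding rs_invariant_def by blast
  then show False using no_321[of a b "Suc i"] assms(2) y(2) by auto
qed

lemma rs_invariant_bump:
  assumes inv: "rs_invariant i A B" and "Suc i \<le> l"
    and ins: "row_insert (\<sigma> (Suc i)) A = (A', Some y)"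
  shows "rs_invariant (Suc i) A' (B @ [y])"
proof -
  let ?x = "\<sigma> (Suc i)"
  have x: "?x \<notin> set A" "?x \<notin> set B" using next_value_not_in_rows[OF inv] by simp_all
  have y: "y \<in> set A" "?x < y" "\<forall>a\<in>set A. ?x < a \<longrightarrow> y \<le> a"
     "set A' = insert ?x (set A - {y})" "sorted_wrt (<) A'"
    using row_insert_Some[OF ins _ x(1)] inv unfolding rs_invariant_def by auto
  have card: "card {a \<in> set A. a \<le> v} = lis \<sigma> {j \<in> {1..i}. \<sigma> j \<le> v}" for v
    using inv unfolding rs_invariant_def by blast
  have "card {a \<in> set A'. a \<le> v} = lis \<sigma> {j \<in> {1..Suc i}. \<sigma> j \<le> v}" for v
  proof -
    consider "v < ?x" | "?x \<le> v" "v < y" | "y \<le> v" by linarith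
    then show ?thesis
    proof cases
      case 1
      then have "{a \<in> set A'. a \<le> v} = {a \<in> set A. a \<le> v}" using y by auto
      then show ?thesis using 1 card lis_values_below_Suc by simp
    next
      case 2
      \<comment> \<open>The bumped entry is the least one above \<open>?x\<close>, so the row has no entry between \<open>?x\<close> and \<open>v\<close>.\<close>
      have 3: "{a \<in> set A. a \<le> ?x} = {a \<in> set A. a \<le> v}"
        using 2 y(3) by (meson le_trans not_le)
      have "{a \<in> set A'. a \<le> v} = insert ?x {a \<in> set A. a \<le> v}" using y 2 by auto
      then have "card {a \<in> set A'. a \<le> v} = Suc (card {a \<in> set A. a \<le> v})" using x by simp
      then show ?thesis using 2 3 card[of v] card[of ?x] lis_values_below_Suc by simp
    next
      case 3
      let ?D = "{a \<in> set A. a \<le> v}"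
      have "{a \<in> set A'. a \<le> v} = insert ?x (?D - {y})" using y 3 by auto
      moreover have "card ?D = Suc (card (?D - {y}))" using y 3 by (intro card.remove) auto
      ultimately have 4: "card {a \<in> set A'. a \<le> v} = card ?D" using x by simp
      \<comment> \<open>The entry \<open>y\<close> alone makes the old count at \<open>v\<close> exceed the one at \<open>?x\<close>: the maximum in the
        recursion is its first argument.\<close>
      have "insert y {a \<in> set A. a \<le> ?x} \<subseteq> ?D" using y 3 by auto
      then have "card (insert y {a \<in> set A. a \<le> ?x}) \<le> card ?D" by (intro card_mono) auto
      then have "Suc (card {a \<in> set A. a \<le> ?x}) \<le> card ?D" using y by simp
      then show ?thesis using 4 y 3 card[of v] card[of ?x] lis_values_below_Suc[of i v]
        by (simp add: max_def)
    qed
  qed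
  moreover have "\<exists>a b. 1 \<le> a \<and> a < b \<and> b \<le> Suc i \<and> \<sigma> a = z \<and> w \<le> \<sigma> b \<and> \<sigma> b < z"
    if "z \<in> set (B @ [y])" "w \<in> set A'" "w < z" for z w
  proof (cases "w = ?x \<or> z = y")
    case True
    \<comment> \<open>For the new second-row entry \<open>z = y\<close> as well, the inserted value completes the descent, because
      the first-row entries below \<open>y\<close> are at most \<open>?x\<close>.\<close>
    have "z \<in> \<sigma> ` {1..i}" using inv that y(1) unfolding rs_invariant_def by auto
    then obtain a where "a \<in> {1..i}" "\<sigma> a = z" by blast
    moreover have "w \<le> ?x" "?x < z" using True that y(2-4) by (auto simp: not_le[symmetric])
    ultimately show ?thesis by (intro exI[of _ a] exI[of _ "Suc i"]) auto
  next
    case False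
    then have "w \<in> set A" "z \<in> set B" using that y by auto
    then show ?thesis using inv that unfolding rs_invariant_def by (meson le_SucI)
  qed
  moreover have "set A' \<union> set (B @ [y]) = insert ?x (set A \<union> set B)"
    using y by auto
  then have "set A' \<union> set (B @ [y]) = \<sigma> ` {1..Suc i}"
    using inv unfolding rs_invariant_def by (auto simp: atLeastAtMostSuc_conv)
  ultimately show ?thesis
    using inv x y bumped_exceeds_second_row[OF assms] unfolding rs_invariant_def
    by (auto simp: sorted_wrt_append)
qed

lemma length_first_row:
  assumes "rs_invariant i A B"
  shows "length A = lis \<sigma> {1..i}"
proof -
  define v where "v = Max (insert 0 (\<sigma> ` {1..i}))"
  have v: "\<sigma> j \<le> v" if "j \<in> {1..i}" for j unfolding v_def using that by (intro Max_ge) auto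
  have "{j \<in> {1..i}. \<sigma> j \<le> v} = {1..i}" using v by auto
  moreover have "{a \<in> set A. a \<le> v} = set A" 
  proof -
    have "set A \<subseteq> \<sigma> ` {1..i}" using assms unfolding rs_invariant_def by blast
    then show ?thesis using v by auto
  qed
  moreover have "card (set A) = length A"
    using assms unfolding rs_invariant_def strict_sorted_iff by (auto intro: distinct_card)
  ultimately show ?thesis using assms unfolding rs_invariant_def by metis
qed

lemma rs_prefix:
  assumes "i \<le> l"
  shows "\<exists>A B. robinson_schensted i \<sigma> = (two_row_tableau i (prefix_growth \<sigma>), two_rows A B) \<and>
    rs_invariant i A B"
  using assms
proof (induction i)
  case 0
  have "rs_invariant 0 [] []" by (simp add: rs_invariant_def)
  moreover have "robinson_schensted 0 \<sigma> = (two_row_tableau 0 (prefix_growth \<sigma>), two_rows [] [])"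
    by (simp add: robinson_schensted_def two_row_tableau_def two_rows_eq)
  ultimately show ?case by blast
next
  case (Suc i)
  then obtain A B where
    rs: "robinson_schensted i \<sigma> = (two_row_tableau i (prefix_growth \<sigma>), two_rows A B)" and
    inv: "rs_invariant i A B" by auto
  have step: "robinson_schensted (Suc i) \<sigma> =
      rs_step \<sigma> (Suc i) (two_row_tableau i (prefix_growth \<sigma>), two_rows A B)"
    using rs by (simp add: robinson_schensted_def)
  define T where "T k = filter (\<lambda>j. prefix_growth \<sigma> j = k) [1..<Suc i]" for k
  have R: "two_row_tableau i (prefix_growth \<sigma>) = two_rows (T 1) (T 0)"
    by (simp add: two_row_tableau_def T_def)
  have R': "two_row_tableau (Suc i) (prefix_growth \<sigma>) =
     two_rows (T 1 @ (if prefix_growth \<sigma> (Suc i) = 1 then [Suc i] else []))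
              (T 0 @ (if prefix_growth \<sigma> (Suc i) = 0 then [Suc i] else []))"
    by (simp only: two_row_tableau_Suc T_def)
  have T1: "T 1 \<noteq> []" if "1 \<le> i" using first_row_nonempty[OF that] by (simp only: T_def not_False_eq_True)
  have growth: "prefix_growth \<sigma> (Suc i) = int (length A') - int (length A)"
    if "rs_invariant (Suc i) A' B'" for A' B'
    using length_first_row[OF that] length_first_row[OF inv]
    by (simp add: prefix_growth_def atLeastLessThanSuc_atLeastAtMost)
  show ?case
  proof (cases "row_insert (\<sigma> (Suc i)) A")
    case (Pair A' b)
    show ?thesis
    proof (cases b)
      case None
      have ins: "row_insert (\<sigma> (Suc i)) A = (A', None)" using Pair None by simp
      have inv': "rs_invariant (Suc i) A' B" by (rule rs_invariant_append[OF inv Suc.prems ins])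
      have "prefix_growth \<sigma> (Suc i) = 1"
        using growth[OF inv'] row_insert_None[OF ins] by simp
      moreover have "B = []" if "A = []"
      proof -
        have "{1..i} = {}" 
        proof (rule ccontr)
          assume "{1..i} \<noteq> {}"
          then have "lis \<sigma> {1..i} \<ge> card {1::nat}" by (intro card_le_lis) (auto simp: monotone_on_def)
          then show False using length_first_row[OF inv] that by simp
        qed
        then show ?thesis using inv unfolding rs_invariant_def by simp
      qed
      moreover have "T 0 = []" if "T 1 = []" using T1 that by (cases "1 \<le> i") (auto simp: T_def)
      ultimately have "robinson_schensted (Suc i) \<sigma> =
          (two_row_tableau (Suc i) (prefix_growth \<sigma>), two_rows A' B)"
        unfolding step rs_step_def R R' by (simp add: tableau_insert_append[OF ins] add_box_first_row)
      then show ?thesis using inv' by blast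
    next
      case (Some y)
      have ins: "row_insert (\<sigma> (Suc i)) A = (A', Some y)" using Pair Some by simp
      have inv': "rs_invariant (Suc i) A' (B @ [y])"
        by (rule rs_invariant_bump[OF inv Suc.prems ins])
      have "length A' = length A" using ins
      proof (induction A arbitrary: A')
        case (Cons a A) then show ?case by (auto split: if_splits prod.splits)
      qed simp
      then have "prefix_growth \<sigma> (Suc i) = 0" using growth[OF inv'] by simp
      moreover have "T 1 \<noteq> []"
      proof -
        have "A \<noteq> []" using ins by auto
        then have "1 \<le> i" using inv unfolding rs_invariant_def by (cases i) auto
        then show ?thesis by (rule T1)
      qed
      ultimately have "robinson_schensted (Suc i) \<sigma> =
          (two_row_tableau (Suc i) (prefix_growth \<sigma>), two_rows A' (B @ [y]))"
        unfolding step rs_step_def R R'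
        using tableau_insert_bump[OF ins bumped_exceeds_second_row[OF inv Suc.prems ins]]
          add_box_second_row[of "T 1" "Suc i" "T 0"] by simp
      then show ?thesis using inv' by blast
    qed
  qed
qed

text \<open>The first row of the insertion tableau is read off from its counting function: \<open>v\<close> is an entry
  exactly when the count of entries at most \<open>v\<close> exceeds the count of those below \<open>v\<close>.\<close>

lemma robinson_schensted_growth:
  "robinson_schensted l \<sigma> =
     (two_row_tableau l (prefix_growth \<sigma>), two_row_tableau l (value_growth l \<sigma>))"
proof -
  obtain A B where rs: "robinson_schensted l \<sigma> = (two_row_tableau l (prefix_growth \<sigma>), two_rows A B)"
    and inv: "rs_invariant l A B" using rs_prefix[of l] by auto
  have AB: "set A \<union> set B = {1..l}" "set A \<inter> set B = {}"
    using inv permutes_image[OF permutes] unfolding rs_invariant_def by auto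
  have growth: "value_growth l \<sigma> v = (if v \<in> set A then 1 else 0)" if v: "v \<in> {1..l}" for v
  proof -
    obtain u where u: "v = Suc u" using v by (cases v) auto
    have *: "value_growth l \<sigma> v = int (card {a \<in> set A. a \<le> v}) - int (card {a \<in> set A. a \<le> u})"
      using inv unfolding rs_invariant_def value_growth_def u by (simp add: less_Suc_eq_le)
    have "{a \<in> set A. a \<le> v} = (if v \<in> set A then insert v else id) {a \<in> set A. a \<le> u}"
      by (auto simp: u le_Suc_eq)
    then show ?thesis unfolding * by (simp add: u)
  qed
  have mem: "v \<in> set A \<longleftrightarrow> v \<in> {1..l} \<and> value_growth l \<sigma> v = 1"
      "v \<in> set B \<longleftrightarrow> v \<in> {1..l} \<and> value_growth l \<sigma> v = 0" for v
  proof -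
    have "v \<in> {1..l} \<longleftrightarrow> v \<in> set A \<or> v \<in> set B" "\<not> (v \<in> set A \<and> v \<in> set B)"
      using AB by blast+
    then show "v \<in> set A \<longleftrightarrow> v \<in> {1..l} \<and> value_growth l \<sigma> v = 1"
        "v \<in> set B \<longleftrightarrow> v \<in> {1..l} \<and> value_growth l \<sigma> v = 0"
      using growth[of v] by (auto split: if_splits)
  qed
  have "set A = set (filter (\<lambda>v. value_growth l \<sigma> v = 1) [1..<Suc l])"
      "set B = set (filter (\<lambda>v. value_growth l \<sigma> v = 0) [1..<Suc l])"
    unfolding set_filter set_upt atLeastLessThanSuc_atLeastAtMost using mem by blast+
  moreover have "sorted_wrt (<) (filter P [1..<Suc l])" for P
    by (rule sorted_wrt_filter) (rule sorted_wrt_upt)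
  moreover have "sorted_wrt (<) A" "sorted_wrt (<) B" using inv unfolding rs_invariant_def by blast+
  ultimately have "A = filter (\<lambda>v. value_growth l \<sigma> v = 1) [1..<Suc l]"
      "B = filter (\<lambda>v. value_growth l \<sigma> v = 0) [1..<Suc l]"
    by (blast intro: strict_sorted_equal)+
  then show ?thesis using rs unfolding two_row_tableau_def by simp
qed

end

section \<open>Strands in coordinates\<close>

text \<open>Defined for every real height \<open>y\<close>, hence also on a neighbourhood of the two boundary lines.\<close>

definition strand_x :: "(nat \<Rightarrow> nat) \<Rightarrow> nat \<Rightarrow> real \<Rightarrow> real" where
  "strand_x \<sigma> i y = y * real i + (1 - y) * real (\<sigma> i)"

lemma mem_strand_iff:
  "p \<in> strand \<sigma> i \<longleftrightarrow> 0 \<le> snd p \<and> snd p \<le> 1 \<and> fst p = strand_x \<sigma> i (snd p)"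
proof
  assume "p \<in> strand \<sigma> i"
  then obtain u where "0 \<le> u" "u \<le> 1" "p = (1 - u) *\<^sub>R top_vertex i + u *\<^sub>R bottom_vertex (\<sigma> i)"
    unfolding strand_def closed_segment_def by blast
  then show "0 \<le> snd p \<and> snd p \<le> 1 \<and> fst p = strand_x \<sigma> i (snd p)"
    by (simp add: top_vertex_def bottom_vertex_def strand_x_def)
next
  assume "0 \<le> snd p \<and> snd p \<le> 1 \<and> fst p = strand_x \<sigma> i (snd p)"
  then show "p \<in> strand \<sigma> i"
    unfolding strand_def closed_segment_def
    by (intro CollectI exI[of _ "1 - snd p"])
       (auto simp: top_vertex_def bottom_vertex_def strand_x_def prod_eq_iff)
qed

lemma mem_strip_iff: "p \<in> strip \<longleftrightarrow> 0 < snd p \<and> snd p < 1"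
  by (cases p) (simp add: strip_def)

lemma mem_strands_iff:
  assumes "p \<in> strip"
  shows "p \<in> strands l \<sigma> \<longleftrightarrow> (\<exists>i\<in>{1..l}. fst p = strand_x \<sigma> i (snd p))"
  using assms by (simp add: strands_def mem_strand_iff mem_strip_iff)

lemma left_of_iff: "p \<in> strip \<Longrightarrow> left_of \<sigma> i p \<longleftrightarrow> fst p < strand_x \<sigma> i (snd p)"
  unfolding left_of_def mem_strand_iff mem_strip_iff
  by (auto intro: exI[of _ "strand_x \<sigma> i (snd p) - fst p"])

lemma right_of_iff: "p \<in> strip \<Longrightarrow> right_of \<sigma> i p \<longleftrightarrow> strand_x \<sigma> i (snd p) < fst p"
  unfolding right_of_def mem_strand_iff mem_strip_iff
  by (auto intro: exI[of _ "fst p - strand_x \<sigma> i (snd p)"])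

lemma strand_x_strict_mono:
  assumes "i < j" "\<sigma> i < \<sigma> j" "0 \<le> y" "y \<le> 1"
  shows "strand_x \<sigma> i y < strand_x \<sigma> j y"
proof (cases "y = 0")
  case False
  have "y * real i < y * real j" using assms False by simp
  moreover have "(1 - y) * real (\<sigma> i) \<le> (1 - y) * real (\<sigma> j)"
    using assms by (intro mult_left_mono) auto
  ultimately show ?thesis unfolding strand_x_def by linarith
qed (use assms in \<open>simp add: strand_x_def\<close>)

lemma inversion_strands_meet:
  assumes "a < b" "\<sigma> b < \<sigma> a"
  obtains y where "0 < y" "y < 1" "strand_x \<sigma> a y = strand_x \<sigma> b y"
proof -
  define s where "s = real (\<sigma> a) - real (\<sigma> b)"
  define t where "t = real b - real a"
  have st: "0 < s" "0 < t" using assms by (auto simp: s_def t_def)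
  define y where "y = s / (s + t)"
  have "0 < y" "y < 1" using st by (auto simp: y_def)
  have "y * t = (1 - y) * s" using st by (simp add: y_def field_simps)
  then have "strand_x \<sigma> a y = strand_x \<sigma> b y"
    unfolding strand_x_def by (simp add: s_def t_def algebra_simps)
  with \<open>0 < y\<close> \<open>y < 1\<close> show thesis by (rule that)
qed

lemma continuous_on_strand_x [continuous_intros]:
  "continuous_on A f \<Longrightarrow> continuous_on A (\<lambda>x. strand_x \<sigma> i (f x))"
  unfolding strand_x_def by (intro continuous_intros)

section \<open>Faces as sets of strands on the left\<close>

definition left_strands :: "nat \<Rightarrow> (nat \<Rightarrow> nat) \<Rightarrow> real \<times> real \<Rightarrow> nat set" where
  "left_strands l \<sigma> p = {i \<in> {1..l}. strand_x \<sigma> i (snd p) < fst p}"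

text \<open>The points of the whole plane that have exactly the strands of \<open>S\<close> (extended to lines) on their
  left. This set is open and contains boundary points of the strip, which is how a face is
  identified from a boundary point in its closure.\<close>

definition separated :: "nat \<Rightarrow> (nat \<Rightarrow> nat) \<Rightarrow> nat set \<Rightarrow> (real \<times> real) set" where
  "separated l \<sigma> S = {p. \<forall>i\<in>{1..l}. if i \<in> S then strand_x \<sigma> i (snd p) < fst p
                                            else fst p < strand_x \<sigma> i (snd p)}"

definition sector :: "nat \<Rightarrow> (nat \<Rightarrow> nat) \<Rightarrow> nat set \<Rightarrow> (real \<times> real) set" where
  "sector l \<sigma> S = strip \<inter> separated l \<sigma> S"

lemma mem_sector_left_strands:
  assumes "p \<in> strip - strands l \<sigma>"
  shows "p \<in> sector l \<sigma> (left_strands l \<sigma> p)"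
  using assms mem_strands_iff[of p l \<sigma>]
  by (auto simp: sector_def separated_def left_strands_def not_less order.order_iff_strict)

lemma sector_subset: "sector l \<sigma> S \<subseteq> strip - strands l \<sigma>"
proof
  fix p assume "p \<in> sector l \<sigma> S"
  then have "p \<in> strip" and sep: "p \<in> separated l \<sigma> S" by (auto simp: sector_def)
  moreover have "fst p \<noteq> strand_x \<sigma> i (snd p)" if "i \<in> {1..l}" for i
    using sep that unfolding separated_def by (auto split: if_splits)
  ultimately show "p \<in> strip - strands l \<sigma>" using mem_strands_iff by blast
qed

lemma left_strands_sector:
  assumes "p \<in> sector l \<sigma> S" "S \<subseteq> {1..l}"
  shows "left_strands l \<sigma> p = S"
proof -
  have "strand_x \<sigma> i (snd p) < fst p \<longleftrightarrow> i \<in> S" if "i \<in> {1..l}" for i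
    using assms(1) that unfolding sector_def separated_def
    by (cases "i \<in> S") (auto dest!: bspec[of _ _ i])
  then show ?thesis using assms(2) unfolding left_strands_def by blast
qed

lemma left_strands_subset: "left_strands l \<sigma> p \<subseteq> {1..l}"
  by (auto simp: left_strands_def)

lemma finite_left_strands: "finite (left_strands l \<sigma> p)"
  by (rule finite_subset[OF left_strands_subset]) simp

text \<open>A strand is affine in the height, so each of the conditions cuts out an open half-plane.\<close>

lemma separated_eq_Inter:
  "separated l \<sigma> S = (\<Inter>i\<in>{1..l}. if i \<in> S
     then {p. inner (-1, real i - real (\<sigma> i)) p < - real (\<sigma> i)}
     else {p. inner (-1, real i - real (\<sigma> i)) p > - real (\<sigma> i)})"
  by (auto simp: separated_def strand_x_def inner_prod_def algebra_simps)

lemma open_separated: "open (separated l \<sigma> S)"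
  unfolding separated_eq_Inter
  by (intro open_INT ballI) (auto simp: open_halfspace_lt open_halfspace_gt)

lemma strip_eq_Times: "strip = UNIV \<times> {0<..<1}"
  by (auto simp: mem_strip_iff)

lemma convex_sector: "convex (sector l \<sigma> S)"
proof -
  have "convex strip" unfolding strip_eq_Times by (intro convex_Times) auto
  moreover have "convex (separated l \<sigma> S)" unfolding separated_eq_Inter
    by (intro convex_INT) (auto simp: convex_halfspace_lt convex_halfspace_gt)
  ultimately show ?thesis unfolding sector_def by (rule convex_Int)
qed

lemma connected_meets_strand:
  assumes "connected T" "p \<in> T" "q \<in> T"
    and "strand_x \<sigma> i (snd p) < fst p" "fst q \<le> strand_x \<sigma> i (snd q)"
  obtains r where "r \<in> T" "fst r = strand_x \<sigma> i (snd r)"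
proof -
  let ?f = "\<lambda>p. strand_x \<sigma> i (snd p) - fst p"
  have "connected (?f ` T)"
    by (intro connected_continuous_image assms(1) continuous_intros continuous_on_fst
        continuous_on_snd continuous_on_id)
  then have "{?f p..?f q} \<subseteq> ?f ` T"
    using assms(2,3) by (intro connected_contains_Icc) auto
  moreover have "0 \<in> {?f p..?f q}" using assms(4,5) by simp
  ultimately have "0 \<in> ?f ` T" by blast
  then show thesis using that by force
qed

lemma left_strands_connected:
  assumes "connected T" "T \<subseteq> strip - strands l \<sigma>" "p \<in> T" "q \<in> T"
  shows "left_strands l \<sigma> p = left_strands l \<sigma> q"
proof -
  have "left_strands l \<sigma> p \<subseteq> left_strands l \<sigma> q" if pq: "p \<in> T" "q \<in> T" for p q
  proof (rule ccontr)
    assume "\<not> ?thesis"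
    then obtain i where i: "i \<in> {1..l}" "strand_x \<sigma> i (snd p) < fst p" "fst q \<le> strand_x \<sigma> i (snd q)"
      unfolding left_strands_def by fastforce
    then obtain r where "r \<in> T" "fst r = strand_x \<sigma> i (snd r)"
      using connected_meets_strand[OF assms(1) pq] by blast
    then show False using assms(2) i(1) mem_strands_iff[of r l \<sigma>] by blast
  qed
  then show ?thesis using assms(3,4) by blast
qed

text \<open>Sectors are convex, and a connected set avoiding the strands cannot change its side of any strand.\<close>

lemma connected_component_eq_sector:
  assumes "p \<in> strip - strands l \<sigma>"
  shows "connected_component_set (strip - strands l \<sigma>) p = sector l \<sigma> (left_strands l \<sigma> p)"
proof
  show "sector l \<sigma> (left_strands l \<sigma> p) \<subseteq> connected_component_set (strip - strands l \<sigma>) p"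
    by (intro connected_component_maximal mem_sector_left_strands assms sector_subset
        convex_connected convex_sector)
  show "connected_component_set (strip - strands l \<sigma>) p \<subseteq> sector l \<sigma> (left_strands l \<sigma> p)"
  proof
    fix q assume "q \<in> connected_component_set (strip - strands l \<sigma>) p"
    then obtain T where T: "connected T" "T \<subseteq> strip - strands l \<sigma>" "p \<in> T" "q \<in> T"
      unfolding connected_component_def by blast
    have "left_strands l \<sigma> p = left_strands l \<sigma> q"
      by (rule left_strands_connected[OF T])
    then show "q \<in> sector l \<sigma> (left_strands l \<sigma> p)"
      using mem_sector_left_strands[of q l \<sigma>] T by auto
  qed
qed

lemma face_eq_sector:
  assumes "F \<in> faces l \<sigma>" "p \<in> F"
  shows "F = sector l \<sigma> (left_strands l \<sigma> p)" and "p \<in> strip - strands l \<sigma>"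
proof -
  obtain x where x: "x \<in> strip - strands l \<sigma>" "F = sector l \<sigma> (left_strands l \<sigma> x)"
    using assms(1) connected_component_eq_sector unfolding faces_def components_iff by metis
  then show "p \<in> strip - strands l \<sigma>" using assms(2) sector_subset by blast
  show "F = sector l \<sigma> (left_strands l \<sigma> p)"
    using left_strands_sector[OF _ left_strands_subset] x(2) assms(2) by metis
qed

lemma face_eq_sectorI:
  assumes "F \<in> faces l \<sigma>" "p \<in> F" "p \<in> sector l \<sigma> S" "S \<subseteq> {1..l}"
  shows "F = sector l \<sigma> S"
  using face_eq_sector(1)[OF assms(1,2)] left_strands_sector[OF assms(3,4)] by simp

lemma sector_in_faces:
  assumes "sector l \<sigma> S \<noteq> {}" "S \<subseteq> {1..l}"
  shows "sector l \<sigma> S \<in> faces l \<sigma>"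
proof -
  obtain p where p: "p \<in> sector l \<sigma> S" using assms(1) by blast
  then have "p \<in> strip - strands l \<sigma>" using sector_subset by blast
  then have "sector l \<sigma> S = connected_component_set (strip - strands l \<sigma>) p"
    using connected_component_eq_sector left_strands_sector[OF p assms(2)] by metis
  then show ?thesis unfolding faces_def components_iff
    using \<open>p \<in> strip - strands l \<sigma>\<close> by blast
qed

text \<open>Near \<open>q\<close> the strip consists only of points of the sector.\<close>

lemma boundary_point_in_closure_face:
  assumes "0 \<le> snd q" "snd q \<le> 1" "q \<in> separated l \<sigma> S" "S \<subseteq> {1..l}"
  shows "F \<in> faces l \<sigma> \<and> q \<in> closure F \<longleftrightarrow> F = sector l \<sigma> S"
proof
  assume F: "F \<in> faces l \<sigma> \<and> q \<in> closure F"
  then have "separated l \<sigma> S \<inter> F \<noteq> {}"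
    using open_separated assms(3) open_Int_closure_eq_empty by blast
  then obtain p where p: "p \<in> F" "p \<in> separated l \<sigma> S" by blast
  moreover have "p \<in> strip" using face_eq_sector(2)[of F l \<sigma> p] F p by blast
  ultimately have "p \<in> sector l \<sigma> S" by (simp add: sector_def)
  then show "F = sector l \<sigma> S" using face_eq_sectorI F p(1) assms(4) by blast
next
  assume F: "F = sector l \<sigma> S"
  have "q \<in> closure strip" unfolding strip_eq_Times closure_Times
    using assms(1,2) by (cases q) auto
  then have "q \<in> closure (separated l \<sigma> S \<inter> strip)"
    using open_Int_closure_subset[OF open_separated] assms(3) by blast
  then have q: "q \<in> closure F" unfolding F sector_def by (simp add: Int_commute)
  then have "F \<noteq> {}" by auto
  then show "F \<in> faces l \<sigma> \<and> q \<in> closure F" using sector_in_faces assms(4) q F by blast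
qed

lemma the_face_near:
  assumes S: "S \<subseteq> {1..l}" and
    near: "\<And>s. 0 < s \<Longrightarrow> s < 1 \<Longrightarrow> 0 \<le> snd (q s) \<and> snd (q s) \<le> 1 \<and> q s \<in> separated l \<sigma> S"
  shows "(THE F. F \<in> faces l \<sigma> \<and> (\<exists>e>0. \<forall>s::real. 0 < s \<and> s < e \<longrightarrow> q s \<in> closure F)) = sector l \<sigma> S"
    and "sector l \<sigma> S \<noteq> {}"
proof -
  have near': "F \<in> faces l \<sigma> \<and> q s \<in> closure F \<longleftrightarrow> F = sector l \<sigma> S" if "0 < s" "s < 1" for F s
    using boundary_point_in_closure_face near[OF that] S by blast
  show "(THE F. F \<in> faces l \<sigma> \<and> (\<exists>e>0. \<forall>s. 0 < s \<and> s < e \<longrightarrow> q s \<in> closure F)) = sector l \<sigma> S"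
  proof (rule the_equality)
    have "sector l \<sigma> S \<in> faces l \<sigma>" using near'[of "1/2"] by auto
    moreover have "\<forall>s. 0 < s \<and> s < 1 \<longrightarrow> q s \<in> closure (sector l \<sigma> S)" using near' by blast
    ultimately show "sector l \<sigma> S \<in> faces l \<sigma> \<and>
        (\<exists>e>0. \<forall>s. 0 < s \<and> s < e \<longrightarrow> q s \<in> closure (sector l \<sigma> S))" 
      using zero_less_one by blast
  next
    fix F assume F: "F \<in> faces l \<sigma> \<and> (\<exists>e>0. \<forall>s. 0 < s \<and> s < e \<longrightarrow> q s \<in> closure F)"
    then obtain e where e: "e > 0" "\<forall>s. 0 < s \<and> s < e \<longrightarrow> q s \<in> closure F" by blast
    define s where "s = min e 1 / 2"
    have "0 < s" "s < e" "s < 1" using e(1) by (auto simp: s_def)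
    then show "F = sector l \<sigma> S" using near'[of s F] e F by blast
  qed
  show "sector l \<sigma> S \<noteq> {}" using near'[of "1/2" "sector l \<sigma> S"] by auto
qed

section \<open>Crossings of concatenated paths\<close>

lemma eventually_at_left_affine:
  fixes t a b :: real
  assumes "a > 0"
  shows "eventually (\<lambda>s. P (a * s + b)) (at_left t) \<longleftrightarrow> eventually P (at_left (a * t + b))"
proof
  assume "eventually (\<lambda>s. P (a * s + b)) (at_left t)"
  then obtain w where w: "w < t" "\<And>s. w < s \<Longrightarrow> s < t \<Longrightarrow> P (a * s + b)"
    unfolding eventually_at_left_field by blast
  have "P s" if "a * w + b < s" "s < a * t + b" for s
    using w(2)[of "(s - b) / a"] that assms by (simp add: field_simps)
  then show "eventually P (at_left (a * t + b))"
    unfolding eventually_at_left_field using w(1) assms by (intro exI[of _ "a * w + b"]) auto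
next
  assume "eventually P (at_left (a * t + b))"
  then obtain w where w: "w < a * t + b" "\<And>s. w < s \<Longrightarrow> s < a * t + b \<Longrightarrow> P s"
    unfolding eventually_at_left_field by blast
  have "P (a * s + b)" if "(w - b) / a < s" "s < t" for s
    using w(2)[of "a * s + b"] that assms by (simp add: field_simps)
  then show "eventually (\<lambda>s. P (a * s + b)) (at_left t)"
    unfolding eventually_at_left_field using w(1) assms
    by (intro exI[of _ "(w - b) / a"]) (auto simp: field_simps)
qed

lemma eventually_at_right_affine:
  fixes t a b :: real
  assumes "a > 0"
  shows "eventually (\<lambda>s. P (a * s + b)) (at_right t) \<longleftrightarrow> eventually P (at_right (a * t + b))"
proof
  assume "eventually (\<lambda>s. P (a * s + b)) (at_right t)"
  then obtain w where w: "w > t" "\<And>s. t < s \<Longrightarrow> s < w \<Longrightarrow> P (a * s + b)"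
    unfolding eventually_at_right_field by blast
  have "P s" if "a * t + b < s" "s < a * w + b" for s
    using w(2)[of "(s - b) / a"] that assms by (simp add: field_simps)
  then show "eventually P (at_right (a * t + b))"
    unfolding eventually_at_right_field using w(1) assms by (intro exI[of _ "a * w + b"]) auto
next
  assume "eventually P (at_right (a * t + b))"
  then obtain w where w: "w > a * t + b" "\<And>s. a * t + b < s \<Longrightarrow> s < w \<Longrightarrow> P s"
    unfolding eventually_at_right_field by blast
  have "P (a * s + b)" if "t < s" "s < (w - b) / a" for s
    using w(2)[of "a * s + b"] that assms by (simp add: field_simps)
  then show "eventually (\<lambda>s. P (a * s + b)) (at_right t)"
    unfolding eventually_at_right_field using w(1) assms
    by (intro exI[of _ "(w - b) / a"]) (auto simp: field_simps)
qed

text \<open>Crossings are local and invariant under increasing affine changes of the parameter, such as the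
  ones on the two halves of a concatenation.\<close>

lemma crossings_at_affine:
  assumes "a > 0" "u < t" "t < v" and eq: "\<And>s. u < s \<Longrightarrow> s < v \<Longrightarrow> \<gamma> s = g (a * s + b)"
  shows "crossings_at l \<sigma> \<gamma> t = crossings_at l \<sigma> g (a * t + b)"
proof -
  have "eventually (\<lambda>s. P (\<gamma> s)) (at_left t) \<longleftrightarrow> eventually (\<lambda>s. P (g s)) (at_left (a * t + b))" for P
  proof -
    have "eventually (\<lambda>s. \<gamma> s = g (a * s + b)) (at_left t)"
      unfolding eventually_at_left_field using assms(2,3) eq by (intro exI[of _ u]) auto
    then have "eventually (\<lambda>s. P (\<gamma> s)) (at_left t) \<longleftrightarrow>
        eventually (\<lambda>s. P (g (a * s + b))) (at_left t)"
      by (rule eventually_cong) simp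
    also have "\<dots> \<longleftrightarrow> eventually (\<lambda>s. P (g s)) (at_left (a * t + b))"
      by (rule eventually_at_left_affine[OF assms(1)])
    finally show ?thesis .
  qed
  moreover have "eventually (\<lambda>s. P (\<gamma> s)) (at_right t) \<longleftrightarrow>
      eventually (\<lambda>s. P (g s)) (at_right (a * t + b))" for P
  proof -
    have "eventually (\<lambda>s. \<gamma> s = g (a * s + b)) (at_right t)"
      unfolding eventually_at_right_field using assms(2,3) eq by (intro exI[of _ v]) auto
    then have "eventually (\<lambda>s. P (\<gamma> s)) (at_right t) \<longleftrightarrow>
        eventually (\<lambda>s. P (g (a * s + b))) (at_right t)"
      by (rule eventually_cong) simp
    also have "\<dots> \<longleftrightarrow> eventually (\<lambda>s. P (g s)) (at_right (a * t + b))"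
      by (rule eventually_at_right_affine[OF assms(1)])
    finally show ?thesis .
  qed
  moreover have "\<gamma> t = g (a * t + b)" by (rule eq[OF assms(2,3)])
  ultimately have "crosses_leftward \<sigma> \<gamma> t = crosses_leftward \<sigma> g (a * t + b)"
    "crosses_rightward \<sigma> \<gamma> t = crosses_rightward \<sigma> g (a * t + b)"
    unfolding crosses_leftward_def crosses_rightward_def fun_eq_iff by simp_all
  then show ?thesis unfolding crossings_at_def crosses_horizontally_def by (simp only:)
qed

text \<open>The junction must not lie on a strand: otherwise a crossing could take place there that neither
  part sees.\<close>

lemma path_crossings_join:
  assumes ends: "pathfinish g = pathstart h" "pathstart g \<notin> strands l \<sigma>"
      "pathfinish g \<notin> strands l \<sigma>" "pathfinish h \<notin> strands l \<sigma>"
    and fin: "finite (meeting_times l \<sigma> g)" "finite (meeting_times l \<sigma> h)"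
  shows "finite (meeting_times l \<sigma> (g +++ h))"
    and "path_crossings l \<sigma> (g +++ h) = path_crossings l \<sigma> g + path_crossings l \<sigma> h"
proof -
  let ?G = "(\<lambda>t. t / 2) ` meeting_times l \<sigma> g"
  let ?H = "(\<lambda>t. (t + 1) / 2) ` meeting_times l \<sigma> h"
  have g: "0 < t" "t < 1" if "t \<in> meeting_times l \<sigma> g" for t
    using that ends unfolding meeting_times_def pathstart_def pathfinish_def
    by (cases "t = 0"; cases "t = 1"; force)+
  have h: "0 < t" "t < 1" if "t \<in> meeting_times l \<sigma> h" for t
    using that ends unfolding meeting_times_def pathstart_def pathfinish_def
    by (cases "t = 0"; cases "t = 1"; force)+
  have split: "meeting_times l \<sigma> (g +++ h) = ?G \<union> ?H"
  proof (intro equalityI subsetI)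
    fix t assume t: "t \<in> meeting_times l \<sigma> (g +++ h)"
    show "t \<in> ?G \<union> ?H"
    proof (cases "t \<le> 1/2")
      case True
      then have "2 * t \<in> meeting_times l \<sigma> g" using t by (auto simp: meeting_times_def joinpaths_def)
      then show ?thesis by (intro UnI1 image_eqI[of _ _ "2 * t"]) auto
    next
      case False
      then have "2 * t - 1 \<in> meeting_times l \<sigma> h" using t by (auto simp: meeting_times_def joinpaths_def)
      then show ?thesis by (intro UnI2 image_eqI[of _ _ "2 * t - 1"]) auto
    qed
  next
    fix t assume "t \<in> ?G \<union> ?H"
    then show "t \<in> meeting_times l \<sigma> (g +++ h)"
    proof
      assume "t \<in> ?G"
      then show ?thesis using g by (auto simp: meeting_times_def joinpaths_def)
    next
      assume "t \<in> ?H"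
      then obtain s where s: "t = (s + 1) / 2" "s \<in> meeting_times l \<sigma> h" by blast
      have "2 * t - 1 = s" "\<not> t \<le> 1 / 2" using h[of s] s by (auto simp: field_simps)
      then have "(g +++ h) t = h s" by (simp add: joinpaths_def)
      moreover have "t \<in> {0..1}" "h s \<in> strands l \<sigma>"
        using h[of s] s by (auto simp: meeting_times_def)
      ultimately show ?thesis unfolding meeting_times_def mem_Collect_eq by metis
    qed
  qed
  then show "finite (meeting_times l \<sigma> (g +++ h))" using fin by simp
  have "crossings_at l \<sigma> (g +++ h) (t / 2) = crossings_at l \<sigma> g t"
    if "t \<in> meeting_times l \<sigma> g" for t
    using crossings_at_affine[of 2 0 "t / 2" "1/2" "g +++ h" g 0 l \<sigma>] g[OF that]
    by (simp add: joinpaths_def)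
  then have G: "sum (crossings_at l \<sigma> (g +++ h)) ?G = path_crossings l \<sigma> g"
    unfolding path_crossings_def by (subst sum.reindex) (auto simp: inj_on_def)
  have "crossings_at l \<sigma> (g +++ h) ((t + 1) / 2) = crossings_at l \<sigma> h t"
    if "t \<in> meeting_times l \<sigma> h" for t
  proof -
    have "crossings_at l \<sigma> (g +++ h) ((t + 1) / 2) = crossings_at l \<sigma> h (2 * ((t + 1) / 2) + - 1)"
      by (rule crossings_at_affine[of 2 "1/2" _ 1]) (use h[OF that] in \<open>auto simp: joinpaths_def\<close>)
    moreover have "2 * ((t + 1) / 2) + - 1 = t" by (simp add: field_simps)
    ultimately show ?thesis by simp
  qed
  then have H: "sum (crossings_at l \<sigma> (g +++ h)) ?H = path_crossings l \<sigma> h"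
    unfolding path_crossings_def by (subst sum.reindex) (auto simp: inj_on_def)
  have "?G \<inter> ?H = {}"
  proof (rule ccontr)
    assume "?G \<inter> ?H \<noteq> {}"
    then obtain s t where "s \<in> meeting_times l \<sigma> g" "t \<in> meeting_times l \<sigma> h" "s / 2 = (t + 1) / 2"
      by blast
    then show False using g(2)[of s] h(1)[of t] by simp
  qed
  then have "path_crossings l \<sigma> (g +++ h) =
      sum (crossings_at l \<sigma> (g +++ h)) ?G + sum (crossings_at l \<sigma> (g +++ h)) ?H"
    unfolding path_crossings_def split using fin by (intro sum.union_disjoint) auto
  then show "path_crossings l \<sigma> (g +++ h) = path_crossings l \<sigma> g + path_crossings l \<sigma> h"
    unfolding G H .
qed

section \<open>Every escape path has enough crossings\<close>

text \<open>The strands lost from the left side at time \<open>t\<close> all pass through \<open>\<gamma> t\<close>. A non-crossing family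
  contains at most one of them, which suffices if the crossing is horizontal; otherwise all of them
  are counted.\<close>

lemma lis_left_strands_across_meeting:
  assumes path: "path \<gamma>" "path_image \<gamma> \<subseteq> strip"
    and times: "0 \<le> b" "b < t" "t < e" "e \<le> 1" "r \<in> {b<..<t}" "s \<in> {t<..<e}"
    and free: "\<And>u. u \<in> {b<..<e} - {t} \<Longrightarrow> \<gamma> u \<notin> strands l \<sigma>"
  shows "lis \<sigma> (left_strands l \<sigma> (\<gamma> r)) \<le> lis \<sigma> (left_strands l \<sigma> (\<gamma> s)) + crossings_at l \<sigma> \<gamma> t"
proof -
  let ?P = "left_strands l \<sigma> (\<gamma> r)" and ?N = "left_strands l \<sigma> (\<gamma> s)"
  have strip: "\<gamma> u \<in> strip" if "u \<in> {b<..<e}" for u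
    using path(2) times that by (auto simp: path_image_def)
  have conn: "connected (\<gamma> ` I)" if "connected I" "I \<subseteq> {b<..<e}" for I
  proof -
    have "I \<subseteq> {0..1}" using that(2) times by force
    then show ?thesis using path(1) that(1) unfolding path_def
      by (meson connected_continuous_image continuous_on_subset)
  qed
  have same: "left_strands l \<sigma> (\<gamma> u) = left_strands l \<sigma> (\<gamma> v)"
    if "u \<in> I" "v \<in> I" "connected I" "I \<subseteq> {b<..<e} - {t}" for I u v
  proof (rule left_strands_connected)
    show "connected (\<gamma> ` I)" using conn that by blast
    show "\<gamma> ` I \<subseteq> strip - strands l \<sigma>" using that(4) strip free by blast
  qed (use that in auto)
  have before: "left_strands l \<sigma> (\<gamma> u) = ?P" if "u \<in> {b<..<t}" for u
    using times that by (intro same[of _ "{b<..<t}"]) auto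
  have after: "left_strands l \<sigma> (\<gamma> u) = ?N" if "u \<in> {t<..<e}" for u
    using times that by (intro same[of _ "{t<..<e}"]) auto
  \<comment> \<open>The path meets the strand somewhere between \<open>r\<close> and \<open>s\<close>, and \<open>t\<close> is the only meeting time there.\<close>
  have leftward: "crosses_leftward \<sigma> \<gamma> t i" if i: "i \<in> ?P - ?N" for i
  proof -
    have il: "i \<in> {1..l}" using i left_strands_subset by blast
    have right: "strand_x \<sigma> i (snd (\<gamma> u)) < fst (\<gamma> u)" if "u \<in> {b<..<t}" for u
      using before[OF that] i by (auto simp: left_strands_def)
    have left: "fst (\<gamma> u) < strand_x \<sigma> i (snd (\<gamma> u))" if "u \<in> {t<..<e}" for u
    proof -
      have u: "u \<in> {b<..<e} - {t}" using that times by auto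
      then have "fst (\<gamma> u) \<noteq> strand_x \<sigma> i (snd (\<gamma> u))"
        using free[OF u] strip[of u] il mem_strands_iff by blast
      moreover have "\<not> strand_x \<sigma> i (snd (\<gamma> u)) < fst (\<gamma> u)"
        using after[OF that] i il by (auto simp: left_strands_def)
      ultimately show ?thesis by simp
    qed
    have "connected (\<gamma> ` {r..s})" using times by (intro conn) auto
    moreover have "\<gamma> r \<in> \<gamma> ` {r..s}" "\<gamma> s \<in> \<gamma> ` {r..s}" using times by auto
    ultimately obtain p where p: "p \<in> \<gamma> ` {r..s}" "fst p = strand_x \<sigma> i (snd p)"
      using right[OF times(5)] left[OF times(6)] connected_meets_strand
      by (metis less_imp_le)
    then obtain u where u: "u \<in> {r..s}" "p = \<gamma> u" by blast
    then have ube: "u \<in> {b<..<e}" using times by auto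
    have "u = t"
    proof (rule ccontr)
      assume "u \<noteq> t"
      then have "\<gamma> u \<notin> strands l \<sigma>" using free ube by blast
      moreover have "fst (\<gamma> u) = strand_x \<sigma> i (snd (\<gamma> u))" using p(2) u(2) by simp
      ultimately show False using mem_strands_iff[OF strip[OF ube], of l \<sigma>] il by blast
    qed
    moreover have "\<gamma> t \<in> strip" using strip times by auto
    ultimately have "\<gamma> t \<in> strand \<sigma> i" using p u
      by (simp add: mem_strand_iff mem_strip_iff)
    moreover have "right_of \<sigma> i (\<gamma> u)" if "u \<in> {b<..<t}" for u
      using right[OF that] right_of_iff strip[of u] that times(3) by simp
    then have "eventually (\<lambda>u. right_of \<sigma> i (\<gamma> u)) (at_left t)"
      unfolding eventually_at_left_field using times(2) by (intro exI[of _ b]) simp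
    moreover have "left_of \<sigma> i (\<gamma> u)" if "u \<in> {t<..<e}" for u
      using left[OF that] left_of_iff strip[of u] that times(2) by simp
    then have "eventually (\<lambda>u. left_of \<sigma> i (\<gamma> u)) (at_right t)"
      unfolding eventually_at_right_field using times(3) by (intro exI[of _ e]) simp
    ultimately show ?thesis unfolding crosses_leftward_def by blast
  qed
  have fin: "finite ?P" "finite ?N" by (rule finite_left_strands)+
  show ?thesis
  proof (rule lis_le_lis_add[OF fin])
    fix C assume C: "C \<subseteq> ?P" "strict_mono_on C \<sigma>"
    show "card (C - ?N) \<le> crossings_at l \<sigma> \<gamma> t"
    proof (cases "crosses_horizontally l \<sigma> \<gamma> t")
      case True
      have "i = j" if "i \<in> C - ?N" "j \<in> C - ?N" "i \<le> j" for i j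
      proof (rule ccontr)
        assume "i \<noteq> j"
        then have "i < j" "\<sigma> i < \<sigma> j" using that C(2) by (auto simp: monotone_on_def)
        moreover have "\<gamma> t \<in> strand \<sigma> i" "\<gamma> t \<in> strand \<sigma> j"
          using leftward that C(1) unfolding crosses_leftward_def by blast+
        ultimately show False
          using strand_x_strict_mono[of i j \<sigma> "snd (\<gamma> t)"] by (simp add: mem_strand_iff)
      qed
      then have "\<forall>i\<in>C - ?N. \<forall>j\<in>C - ?N. i = j" by (metis nat_le_linear)
      moreover have "finite (C - ?N)" using C(1) fin(1) finite_subset by blast
      ultimately have "card (C - ?N) \<le> Suc 0" using card_le_Suc0_iff_eq by blast
      then show ?thesis using True by (simp add: crossings_at_def)
    next
      case False
      have "C - ?N \<subseteq> {i \<in> {1..l}. crosses_leftward \<sigma> \<gamma> t i \<or> crosses_rightward \<sigma> \<gamma> t i}"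
        using leftward C(1) left_strands_subset by blast
      then show ?thesis using False by (simp add: crossings_at_def card_mono)
    qed
  qed
qed

lemma lis_left_strands_along_path:
  assumes path: "path \<gamma>" "path_image \<gamma> \<subseteq> strip"
    and fin: "finite (meeting_times l \<sigma> \<gamma>)" and start: "0 \<notin> meeting_times l \<sigma> \<gamma>"
    and s: "s \<in> {0..1} - meeting_times l \<sigma> \<gamma>"
  shows "lis \<sigma> (left_strands l \<sigma> (\<gamma> 0)) \<le> lis \<sigma> (left_strands l \<sigma> (\<gamma> s)) +
    sum (crossings_at l \<sigma> \<gamma>) {t \<in> meeting_times l \<sigma> \<gamma>. t < s}"
  using s
proof (induction "card {t \<in> meeting_times l \<sigma> \<gamma>. t < s}" arbitrary: s rule: less_induct)
  case less
  let ?M = "meeting_times l \<sigma> \<gamma>"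
  have M: "t \<in> ?M \<longleftrightarrow> t \<in> {0..1} \<and> \<gamma> t \<in> strands l \<sigma>" for t by (auto simp: meeting_times_def)
  have off: "\<gamma> u \<in> strip - strands l \<sigma>" if "u \<in> {0..1}" "u \<notin> ?M" for u
    using path(2) that M by (auto simp: path_image_def)
  show ?case
  proof (cases "{t \<in> ?M. t < s} = {}")
    case True
    have "left_strands l \<sigma> (\<gamma> 0) = left_strands l \<sigma> (\<gamma> s)"
    proof (rule left_strands_connected)
      show "connected (\<gamma> ` {0..s})" using path(1) less.prems unfolding path_def
        by (intro connected_continuous_image) (auto intro: continuous_on_subset)
      have "{0..s} \<inter> ?M = {}" using True less.prems by (auto simp: order.order_iff_strict)
      then show "\<gamma> ` {0..s} \<subseteq> strip - strands l \<sigma>"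
        using off less.prems by fastforce
    qed (use less.prems in auto)
    then show ?thesis by simp
  next
    case False
    define t where "t = Max {t \<in> ?M. t < s}"
    have "t \<in> {t \<in> ?M. t < s}" unfolding t_def using False fin by (intro Max_in) auto
    then have t: "t \<in> ?M" "t < s" "0 < t"
      using start M by (auto simp: order.order_iff_strict)
    have last: "u \<le> t" if "u \<in> ?M" "u < s" for u
      unfolding t_def using that fin by (intro Max_ge) auto
    \<comment> \<open>The induction hypothesis applies at a time \<open>r\<close> between the last two meeting times \<open>b\<close> and \<open>t\<close>,
      where \<open>b = 0\<close> if \<open>t\<close> is the only one.\<close>
    define b where "b = Max (insert 0 {u \<in> ?M. u < t})"
    have "b \<in> insert 0 {u \<in> ?M. u < t}" unfolding b_def using fin by (intro Max_in) auto
    then have b: "0 \<le> b" "b < t" using t M by auto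
    have gap: "u \<le> b" if "u \<in> ?M" "u < t" for u
      unfolding b_def using that fin by (intro Max_ge) auto
    define r where "r = (b + t) / 2"
    have r: "b < r" "r < t" using b by (auto simp: r_def)
    have free: "u \<notin> ?M" if "u \<in> {b<..<s} - {t}" for u
      using gap[of u] last[of u] that by fastforce
    have "r \<in> {0..1} - ?M" using r b t less.prems free[of r] by auto
    moreover have Ms: "{u \<in> ?M. u < s} = insert t {u \<in> ?M. u < r}"
      using gap last t r by fastforce
    moreover have "t \<notin> {u \<in> ?M. u < r}" "finite {u \<in> ?M. u < r}" using r fin by auto
    ultimately have "lis \<sigma> (left_strands l \<sigma> (\<gamma> 0)) \<le> lis \<sigma> (left_strands l \<sigma> (\<gamma> r)) +
        sum (crossings_at l \<sigma> \<gamma>) {u \<in> ?M. u < r}"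
      by (intro less.hyps) auto
    moreover have "lis \<sigma> (left_strands l \<sigma> (\<gamma> r)) \<le>
        lis \<sigma> (left_strands l \<sigma> (\<gamma> s)) + crossings_at l \<sigma> \<gamma> t"
    proof -
      let ?s' = "(t + s) / 2"
      have "lis \<sigma> (left_strands l \<sigma> (\<gamma> r)) \<le>
          lis \<sigma> (left_strands l \<sigma> (\<gamma> ?s')) + crossings_at l \<sigma> \<gamma> t"
      proof (rule lis_left_strands_across_meeting[OF path b(1,2) t(2)])
        fix u assume "u \<in> {b<..<s} - {t}"
        then show "\<gamma> u \<notin> strands l \<sigma>" using free M b less.prems by fastforce
      qed (use r t less.prems in auto)
      moreover have "left_strands l \<sigma> (\<gamma> ?s') = left_strands l \<sigma> (\<gamma> s)"
      proof (rule left_strands_connected)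
        have "{?s'..s} \<subseteq> {0..1}" using t less.prems by auto
        then show "connected (\<gamma> ` {?s'..s})" using path(1) unfolding path_def
          by (intro connected_continuous_image) (auto intro: continuous_on_subset)
        have "u \<notin> ?M" if "u \<in> {?s'..s}" for u
          using that free[of u] less.prems t b by (cases "u = s") (auto simp del: One_nat_def)
        then show "\<gamma> ` {?s'..s} \<subseteq> strip - strands l \<sigma>"
          using off \<open>{?s'..s} \<subseteq> {0..1}\<close> by blast
      qed (use t in auto)
      ultimately show ?thesis by simp
    qed
    ultimately show ?thesis
      unfolding Ms using \<open>t \<notin> {u \<in> ?M. u < r}\<close> \<open>finite {u \<in> ?M. u < r}\<close> by simp
  qed
qed

lemma face_infinity_eq: "face_infinity l \<sigma> = sector l \<sigma> {}"
  unfolding face_infinity_def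
proof (rule the_equality)
  have pos: "0 < strand_x \<sigma> i y" if "i \<in> {1..l}" "0 < y" "y < 1" for i y
    unfolding strand_x_def using that by (intro add_pos_nonneg) auto
  have *: "(x, y) \<in> sector l \<sigma> {}" if "x < 0" "0 < y" "y < 1" for x y
    using that pos by (fastforce simp: sector_def separated_def mem_strip_iff)
  have "sector l \<sigma> {} \<noteq> {}" using *[of "-1" "1/2"] by force
  then have "sector l \<sigma> {} \<in> faces l \<sigma>" by (rule sector_in_faces) simp
  then show "sector l \<sigma> {} \<in> faces l \<sigma> \<and>
      (\<exists>c. \<forall>x y. x < c \<and> 0 < y \<and> y < 1 \<longrightarrow> (x, y) \<in> sector l \<sigma> {})"
    using * by blast
  fix F assume F: "F \<in> faces l \<sigma> \<and> (\<exists>c. \<forall>x y. x < c \<and> 0 < y \<and> y < 1 \<longrightarrow> (x, y) \<in> F)"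
  then obtain c where "\<forall>x y. x < c \<and> 0 < y \<and> y < 1 \<longrightarrow> (x, y) \<in> F" by blast
  then have "(min c 0 - 1, 1/2) \<in> F" by auto
  moreover have "(min c 0 - 1, 1/2) \<in> sector l \<sigma> {}" by (intro *) auto
  ultimately show "F = sector l \<sigma> {}" using F by (intro face_eq_sectorI) auto
qed

lemma lis_le_path_crossings:
  assumes "escape_path l \<sigma> (sector l \<sigma> S) \<gamma>" "S \<subseteq> {1..l}"
  shows "lis \<sigma> S \<le> path_crossings l \<sigma> \<gamma>"
proof -
  have path: "path \<gamma>" "path_image \<gamma> \<subseteq> strip" "finite (meeting_times l \<sigma> \<gamma>)"
    and ends: "\<gamma> 0 \<in> sector l \<sigma> S" "\<gamma> 1 \<in> sector l \<sigma> {}"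
    using assms(1) face_infinity_eq
    unfolding escape_path_def pathstart_def pathfinish_def by simp_all
  have not_meet: "0 \<notin> meeting_times l \<sigma> \<gamma>" "1 \<notin> meeting_times l \<sigma> \<gamma>"
    using ends sector_subset unfolding meeting_times_def by blast+
  have "lis \<sigma> (left_strands l \<sigma> (\<gamma> 0)) \<le> lis \<sigma> (left_strands l \<sigma> (\<gamma> 1)) +
      sum (crossings_at l \<sigma> \<gamma>) {t \<in> meeting_times l \<sigma> \<gamma>. t < 1}"
    using not_meet by (intro lis_left_strands_along_path path) auto
  moreover have "sum (crossings_at l \<sigma> \<gamma>) {t \<in> meeting_times l \<sigma> \<gamma>. t < 1} \<le> path_crossings l \<sigma> \<gamma>"
    unfolding path_crossings_def using path(3) by (intro sum_mono2) auto
  moreover have "left_strands l \<sigma> (\<gamma> 0) = S" "left_strands l \<sigma> (\<gamma> 1) = {}"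
    using ends assms(2) left_strands_sector by auto
  ultimately show ?thesis by simp
qed

section \<open>Escaping through crossing points\<close>

text \<open>A short horizontal path through \<open>c\<close> crosses every strand through \<open>c\<close> in the same direction, so it
  counts at most one crossing however many strands there are.\<close>

lemma path_crossings_horizontal_le_1:
  fixes c :: "real \<times> real" and e :: real
  assumes c: "c \<in> strip" and e: "0 < e"
    and clear: "\<And>i. i \<in> {1..l} \<Longrightarrow> strand_x \<sigma> i (snd c) \<noteq> fst c \<Longrightarrow>
      e < \<bar>strand_x \<sigma> i (snd c) - fst c\<bar>"
  defines "\<gamma> \<equiv> linepath (c + (e, 0)) (c - (e, 0))"
  shows "path_image \<gamma> \<subseteq> strip" "finite (meeting_times l \<sigma> \<gamma>)" "path_crossings l \<sigma> \<gamma> \<le> 1"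
proof -
  have coord: "fst (\<gamma> t) = fst c + (1 - 2 * t) * e" "snd (\<gamma> t) = snd c" for t
    by (simp_all add: \<gamma>_def linepath_def algebra_simps)
  have in_strip: "\<gamma> t \<in> strip" for t using c coord by (simp add: mem_strip_iff)
  then show "path_image \<gamma> \<subseteq> strip" by (auto simp: path_image_def)
  have half: "\<gamma> (1/2) = c" by (simp add: prod_eq_iff coord)
  have "t = 1/2" if t: "t \<in> meeting_times l \<sigma> \<gamma>" for t
  proof (rule ccontr)
    assume ne: "t \<noteq> 1/2"
    have "\<gamma> t \<in> strands l \<sigma>" "0 \<le> t" "t \<le> 1" using t by (auto simp: meeting_times_def)
    then obtain i where i: "i \<in> {1..l}" "fst c + (1 - 2 * t) * e = strand_x \<sigma> i (snd c)"
      using mem_strands_iff[OF in_strip] coord by metis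
    have "\<bar>1 - 2 * t\<bar> * e \<le> 1 * e" using \<open>0 \<le> t\<close> \<open>t \<le> 1\<close> e by (intro mult_right_mono) auto
    then have "\<bar>strand_x \<sigma> i (snd c) - fst c\<bar> \<le> e" using e by (simp add: i(2)[symmetric] abs_mult)
    then have "strand_x \<sigma> i (snd c) = fst c" using clear[OF i(1)] by force
    then show False using i(2) ne e by simp
  qed
  then have sub: "meeting_times l \<sigma> \<gamma> \<subseteq> {1/2}" by blast
  then show "finite (meeting_times l \<sigma> \<gamma>)" using finite_subset by blast
  have leftward: "crosses_leftward \<sigma> \<gamma> (1/2) i" if "strand_x \<sigma> i (snd c) = fst c" for i
    unfolding crosses_leftward_def
  proof (intro conjI)
    show "\<gamma> (1/2) \<in> strand \<sigma> i" using c that half by (simp add: mem_strand_iff mem_strip_iff)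
    have "right_of \<sigma> i (\<gamma> u)" if "u < 1/2" for u
      using that \<open>strand_x \<sigma> i (snd c) = fst c\<close> e by (simp add: right_of_iff[OF in_strip] coord)
    then show "eventually (\<lambda>u. right_of \<sigma> i (\<gamma> u)) (at_left (1/2))"
      unfolding eventually_at_left_field by (intro exI[of _ 0]) simp
    have "left_of \<sigma> i (\<gamma> u)" if "1/2 < u" for u
      using that \<open>strand_x \<sigma> i (snd c) = fst c\<close> e
      by (simp add: left_of_iff[OF in_strip] coord mult_neg_pos)
    then show "eventually (\<lambda>u. left_of \<sigma> i (\<gamma> u)) (at_right (1/2))"
      unfolding eventually_at_right_field by (intro exI[of _ 1]) simp
  qed
  let ?K = "{i \<in> {1..l}. crosses_leftward \<sigma> \<gamma> (1/2) i \<or> crosses_rightward \<sigma> \<gamma> (1/2) i}"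
  have "crossings_at l \<sigma> \<gamma> (1/2) \<le> 1"
  proof (cases "crosses_horizontally l \<sigma> \<gamma> (1/2)")
    case False
    have "i = j" if "i \<in> ?K" "j \<in> ?K" for i j
    proof (rule ccontr)
      assume "i \<noteq> j"
      have "c \<in> strand \<sigma> i" "c \<in> strand \<sigma> j"
        using that half unfolding crosses_leftward_def crosses_rightward_def by auto
      then have "crosses_leftward \<sigma> \<gamma> (1/2) i" "crosses_leftward \<sigma> \<gamma> (1/2) j"
        using leftward by (simp_all add: mem_strand_iff)
      then show False using False \<open>i \<noteq> j\<close> that unfolding crosses_horizontally_def by blast
    qed
    then have "card ?K \<le> Suc 0" by (subst card_le_Suc0_iff_eq) auto
    then show ?thesis using False by (simp add: crossings_at_def)
  qed (simp add: crossings_at_def)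
  moreover have "path_crossings l \<sigma> \<gamma> \<le> sum (crossings_at l \<sigma> \<gamma>) {1/2}"
    unfolding path_crossings_def by (rule sum_mono2) (use sub in auto)
  ultimately show "path_crossings l \<sigma> \<gamma> \<le> 1" by simp
qed

lemma path_within_sector:
  assumes "p \<in> sector l \<sigma> S" "q \<in> sector l \<sigma> S"
  shows "path_image (linepath p q) \<subseteq> strip" "meeting_times l \<sigma> (linepath p q) = {}"
proof -
  have "closed_segment p q \<subseteq> strip - strands l \<sigma>"
    using closed_segment_subset[OF assms convex_sector] sector_subset by blast
  moreover have "linepath p q t \<in> closed_segment p q" if "t \<in> {0..1}" for t
    using linepath_in_path that by blast
  ultimately show "path_image (linepath p q) \<subseteq> strip" "meeting_times l \<sigma> (linepath p q) = {}"
    unfolding meeting_times_def path_image_linepath by blast+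
qed

text \<open>Here \<open>A\<close> is the set of strands through \<open>c\<close>; a small enough step to the right of \<open>c\<close> has all of them
  on its left, a small enough step to the left has none of them.\<close>

lemma sector_clear_radius:
  assumes c: "c \<in> strip" and S: "S \<subseteq> {1..l}"
    and left: "\<And>i. i \<in> S - A \<Longrightarrow> strand_x \<sigma> i (snd c) < fst c"
    and through: "\<And>i. i \<in> A \<Longrightarrow> strand_x \<sigma> i (snd c) = fst c"
    and right: "\<And>i. i \<in> {1..l} - S \<Longrightarrow> fst c < strand_x \<sigma> i (snd c)"
    and A: "A \<subseteq> S"
  obtains e where "0 < e" "c + (e, 0) \<in> sector l \<sigma> S" "c - (e, 0) \<in> sector l \<sigma> (S - A)"
    "\<And>i. i \<in> {1..l} \<Longrightarrow> strand_x \<sigma> i (snd c) \<noteq> fst c \<Longrightarrow> e < \<bar>strand_x \<sigma> i (snd c) - fst c\<bar>"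
proof -
  define D where "D = insert 1 ((\<lambda>i. \<bar>strand_x \<sigma> i (snd c) - fst c\<bar>) ` ({1..l} - A))"
  have "x > 0" if "x \<in> D" for x using that left right unfolding D_def by fastforce
  moreover have D: "finite D" "D \<noteq> {}" by (auto simp: D_def)
  ultimately have pos: "Min D > 0" by simp
  define e where "e = Min D / 2"
  have e: "0 < e" using pos by (simp add: e_def)
  have far: "e < \<bar>strand_x \<sigma> i (snd c) - fst c\<bar>" if "i \<in> {1..l} - A" for i
  proof -
    have "Min D \<le> \<bar>strand_x \<sigma> i (snd c) - fst c\<bar>"
      using D(1) that unfolding D_def by (intro Min_le) auto
    then show ?thesis using pos by (simp add: e_def)
  qed
  show thesis
  proof (rule that[OF e])
    have "if i \<in> S then strand_x \<sigma> i (snd c) < fst c + e else fst c + e < strand_x \<sigma> i (snd c)"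
      if i: "i \<in> {1..l}" for i
    proof -
      consider "i \<in> A" "i \<in> S" | "i \<in> S - A" | "i \<in> {1..l} - S" "i \<notin> A" using i A by blast
      then show ?thesis
        by cases (use e through[of i] left[of i] right[of i] far[of i] i in auto)
    qed
    then show "c + (e, 0) \<in> sector l \<sigma> S" using c
      unfolding sector_def separated_def by (simp add: mem_strip_iff)
    have "if i \<in> S - A then strand_x \<sigma> i (snd c) < fst c - e else fst c - e < strand_x \<sigma> i (snd c)"
      if i: "i \<in> {1..l}" for i
    proof -
      consider "i \<in> A" "i \<in> S" | "i \<in> S - A" | "i \<in> {1..l} - S" "i \<notin> A" using i A by blast
      then show ?thesis
        by cases (use e through[of i] left[of i] right[of i] far[of i] i in auto)
    qed
    then show "c - (e, 0) \<in> sector l \<sigma> (S - A)" using c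
      unfolding sector_def separated_def by (simp add: mem_strip_iff)
  qed (use far through in blast)
qed

text \<open>The maximal elements of \<open>S\<close> for the strict order in which one strand lies entirely to the left of
  another.\<close>

definition rightmost :: "(nat \<Rightarrow> nat) \<Rightarrow> nat set \<Rightarrow> nat set" where
  "rightmost \<sigma> S = {m \<in> S. \<not> (\<exists>j\<in>S. m < j \<and> \<sigma> m < \<sigma> j)}"

lemma rightmost_dominates:
  assumes "finite S" "i \<in> S - rightmost \<sigma> S"
  obtains m where "m \<in> rightmost \<sigma> S" "i < m" "\<sigma> i < \<sigma> m"
proof -
  let ?U = "{j \<in> S. i < j \<and> \<sigma> i < \<sigma> j}"
  have U: "finite ?U" "?U \<noteq> {}" using assms by (auto simp: rightmost_def)
  define m where "m = Max ?U"
  have m: "m \<in> ?U" unfolding m_def using U by (rule Max_in)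
  have max: "j \<le> m" if "j \<in> ?U" for j unfolding m_def using U(1) that by (rule Max_ge)
  have "\<not> (\<exists>j\<in>S. m < j \<and> \<sigma> m < \<sigma> j)"
  proof
    assume "\<exists>j\<in>S. m < j \<and> \<sigma> m < \<sigma> j"
    then obtain j where j: "j \<in> S" "m < j" "\<sigma> m < \<sigma> j" by blast
    then have "j \<in> ?U" using m by auto
    then show False using max j(2) by fastforce
  qed
  then show thesis using m that[of m] by (simp add: rightmost_def)
qed

text \<open>A non-crossing family without rightmost strands extends by a rightmost strand that lies to the
  right of its last member.\<close>

lemma lis_remove_rightmost:
  assumes "finite S" "S \<noteq> {}"
  shows "Suc (lis \<sigma> (S - rightmost \<sigma> S)) \<le> lis \<sigma> S"
proof -
  obtain D where D: "D \<subseteq> S - rightmost \<sigma> S" "strict_mono_on D \<sigma>"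
      "card D = lis \<sigma> (S - rightmost \<sigma> S)"
    using lis_attained[of "S - rightmost \<sigma> S" \<sigma>] assms(1) by auto
  have finD: "finite D" using D(1) assms(1) finite_subset[of D S] by auto
  obtain m where m: "m \<in> rightmost \<sigma> S" "\<And>i. i \<in> D \<Longrightarrow> i < m \<and> \<sigma> i < \<sigma> m"
  proof (cases "D = {}")
    case True
    obtain i where "i \<in> S" using assms(2) by blast
    then obtain m where "m \<in> rightmost \<sigma> S"
      using rightmost_dominates[OF assms(1), of i \<sigma>] by blast
    then show thesis using that[of m] True by simp
  next
    case False
    have k: "Max D \<in> D" using finD False by (rule Max_in)
    then obtain m where m: "m \<in> rightmost \<sigma> S" "Max D < m" "\<sigma> (Max D) < \<sigma> m"
      using rightmost_dominates[OF assms(1), of "Max D" \<sigma>] D(1) by blast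
    have "i < m \<and> \<sigma> i < \<sigma> m" if "i \<in> D" for i
    proof (cases "i = Max D")
      case False
      then have "i < Max D" using Max_ge[OF finD that] by simp
      then show ?thesis using D(2) that k m unfolding monotone_on_def
        by (meson less_trans)
    qed (use m in simp)
    then show thesis using that[of m] m(1) by blast
  qed
  have "strict_mono_on (insert m D) \<sigma>"
    unfolding monotone_on_def
  proof (intro ballI impI)
    fix i j assume "i \<in> insert m D" "j \<in> insert m D" "i < j"
    then show "\<sigma> i < \<sigma> j" using D(2) m(2) unfolding monotone_on_def
      by (metis insertE less_asym less_irrefl)
  qed
  moreover have "insert m D \<subseteq> S" using D(1) m(1) by (auto simp: rightmost_def)
  moreover have "m \<notin> D" using m(2) by blast
  ultimately show ?thesis using card_le_lis[OF assms(1), of "insert m D" \<sigma>] D(3) finD by simp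
qed

context avoiding_permutation
begin

lemma rightmost_decreasing:
  assumes "a \<in> rightmost \<sigma> S" "b \<in> rightmost \<sigma> S" "a < b"
  shows "\<sigma> b < \<sigma> a"
  using assms inj[of a b] by (auto simp: rightmost_def)

text \<open>Rightmost strands pairwise form inversions, and three of them would form a 321 pattern.\<close>

lemma rightmost_cases:
  assumes "S \<subseteq> {1..l}" "S \<noteq> {}"
  obtains a where "rightmost \<sigma> S = {a}"
  | a b where "rightmost \<sigma> S = {a, b}" "a < b" "\<sigma> b < \<sigma> a"
proof -
  have fin: "finite S" by (rule finite_subset[OF assms(1)]) simp
  obtain i where "i \<in> S" using assms(2) by blast
  then obtain a0 where a0: "a0 \<in> rightmost \<sigma> S"
    using rightmost_dominates[OF fin, of i \<sigma>] by blast
  show thesis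
  proof (cases "rightmost \<sigma> S = {a0}")
    case False
    then obtain b0 where b0: "b0 \<in> rightmost \<sigma> S" "b0 \<noteq> a0" using a0 by blast
    define a b where "a = min a0 b0" and "b = max a0 b0"
    have ab: "a \<in> rightmost \<sigma> S" "b \<in> rightmost \<sigma> S" "a < b"
      using a0 b0 by (auto simp: a_def b_def min_def max_def)
    have "e \<in> {a, b}" if e: "e \<in> rightmost \<sigma> S" for e
    proof (rule ccontr)
      assume "e \<notin> {a, b}"
      have no: False if "x \<in> rightmost \<sigma> S" "y \<in> rightmost \<sigma> S" "z \<in> rightmost \<sigma> S" "x < y" "y < z"
        for x y z
      proof -
        have "1 \<le> x" "z \<le> l" using that assms(1) by (auto simp: rightmost_def)
        then show False using no_321[of x y z] rightmost_decreasing that by blast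
      qed
      consider "e < a" | "a < e" "e < b" | "b < e" using \<open>e \<notin> {a, b}\<close> by fastforce
      then show False using no e ab by cases blast+
    qed
    then have "rightmost \<sigma> S = {a, b}" using ab by blast
    then show thesis using that(2) ab rightmost_decreasing by blast
  qed (rule that(1))
qed

text \<open>If there is a single rightmost strand, the exit point \<open>c\<close> lies on it at the height of \<open>p\<close>. If there are two,
  \<open>c\<close> is their intersection: a strand \<open>i\<close> to the right of \<open>p\<close> cannot cross both of them, and it stays
  to the right of the one that it does not cross.\<close>

lemma rightmost_exit_point:
  assumes S: "S \<subseteq> {1..l}" "S \<noteq> {}" and p: "p \<in> sector l \<sigma> S"
  obtains c where "c \<in> strip"
    "\<And>i. i \<in> S - rightmost \<sigma> S \<Longrightarrow> strand_x \<sigma> i (snd c) < fst c"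
    "\<And>i. i \<in> rightmost \<sigma> S \<Longrightarrow> strand_x \<sigma> i (snd c) = fst c"
    "\<And>i. i \<in> {1..l} - S \<Longrightarrow> fst c < strand_x \<sigma> i (snd c)"
proof -
  have fin: "finite S" by (rule finite_subset[OF S(1)]) simp
  have p01: "0 < snd p" "snd p < 1" using p by (auto simp: sector_def mem_strip_iff)
  have pl: "strand_x \<sigma> i (snd p) < fst p" if "i \<in> S" for i
    using p that S(1) unfolding sector_def separated_def by (auto dest!: bspec[of _ _ i])
  have pr: "fst p < strand_x \<sigma> i (snd p)" if "i \<in> {1..l} - S" for i
    using p that unfolding sector_def separated_def by (auto dest!: bspec[of _ _ i])
  have left: "strand_x \<sigma> i (snd c) < fst c"
    if i: "i \<in> S - rightmost \<sigma> S" and c: "c \<in> strip"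
      "\<And>m. m \<in> rightmost \<sigma> S \<Longrightarrow> strand_x \<sigma> m (snd c) = fst c" for i c
  proof -
    obtain m where m: "m \<in> rightmost \<sigma> S" "i < m" "\<sigma> i < \<sigma> m"
      using rightmost_dominates[OF fin i] by blast
    have "strand_x \<sigma> i (snd c) < strand_x \<sigma> m (snd c)"
      using m(2,3) c(1) by (intro strand_x_strict_mono) (auto simp: mem_strip_iff)
    then show ?thesis using c(2)[OF m(1)] by simp
  qed
  show thesis
    using rightmost_cases[OF S]
  proof cases
    case (1 a)
    let ?c = "(strand_x \<sigma> a (snd p), snd p)"
    have aS: "a \<in> S" using 1 by (auto simp: rightmost_def)
    have "?c \<in> strip" using p01 by (simp add: mem_strip_iff)
    moreover have "strand_x \<sigma> i (snd ?c) = fst ?c" if "i \<in> rightmost \<sigma> S" for i using that 1 by simp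
    moreover have "fst ?c < strand_x \<sigma> i (snd ?c)" if "i \<in> {1..l} - S" for i
      using pr[OF that] pl[OF aS] by simp
    ultimately show thesis using left by (intro that[of ?c]) blast+
  next
    case (2 a b)
    obtain y where y: "0 < y" "y < 1" "strand_x \<sigma> a y = strand_x \<sigma> b y"
      using inversion_strands_meet[of a b \<sigma>] 2(2,3) by blast
    let ?c = "(strand_x \<sigma> a y, y)"
    have abS: "a \<in> S" "b \<in> S" using 2 by (auto simp: rightmost_def)
    have "?c \<in> strip" using y by (simp add: mem_strip_iff)
    moreover have "strand_x \<sigma> i (snd ?c) = fst ?c" if "i \<in> rightmost \<sigma> S" for i using that 2 y by auto
    moreover have "fst ?c < strand_x \<sigma> i (snd ?c)" if i: "i \<in> {1..l} - S" for i
    proof -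
      have ne: "i \<noteq> a" "i \<noteq> b" using i abS by auto
      have "\<exists>k\<in>{a, b}. (i < k \<and> \<sigma> i < \<sigma> k) \<or> (k < i \<and> \<sigma> k < \<sigma> i)"
      proof (rule ccontr)
        assume no: "\<not> ?thesis"
        have ord: "\<sigma> i \<noteq> \<sigma> a" "\<sigma> i \<noteq> \<sigma> b" using ne inj by auto
        have range: "1 \<le> i" "i \<le> l" "1 \<le> a" "b \<le> l" using i abS S(1) by auto
        consider "i < a" | "a < i" "i < b" | "b < i" using ne by linarith
        then show False
        proof cases
          case 1
          then have "\<sigma> a < \<sigma> i" using no ord by auto
          then show False using no_321[of i a b] 1 2(2,3) range by blast
        next
          case 2
          then have "\<sigma> i < \<sigma> a" "\<sigma> b < \<sigma> i" using no ord by auto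
          then show False using no_321[of a i b] 2 range by blast
        next
          case 3
          then have "\<sigma> i < \<sigma> b" using no ord by auto
          then show False using no_321[of a b i] 3 2(2,3) range by blast
        qed
      qed
      then obtain k where k: "k \<in> {a, b}" "(i < k \<and> \<sigma> i < \<sigma> k) \<or> (k < i \<and> \<sigma> k < \<sigma> i)" by blast
      have "strand_x \<sigma> k (snd p) < strand_x \<sigma> i (snd p)"
        using pl[of k] pr[OF i] k(1) abS by auto
      then have "k < i \<and> \<sigma> k < \<sigma> i"
        using k(2) strand_x_strict_mono[of i k \<sigma> "snd p"] p01 by force
      then have "strand_x \<sigma> k y < strand_x \<sigma> i y"
        using y by (intro strand_x_strict_mono) auto
      then show ?thesis using k(1) y(3) by auto
    qed
    ultimately show thesis using left by (intro that[of ?c]) blast+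
  qed
qed

text \<open>From \<open>p\<close> the path goes to a point just right of the exit point without leaving the face, steps
  through the exit point with one crossing, and continues by induction.\<close>

lemma escape_within_lis:
  assumes "S \<subseteq> {1..l}" "p \<in> sector l \<sigma> S"
  shows "\<exists>\<gamma>. path \<gamma> \<and> path_image \<gamma> \<subseteq> strip \<and> pathstart \<gamma> = p \<and> pathfinish \<gamma> \<in> sector l \<sigma> {} \<and>
    finite (meeting_times l \<sigma> \<gamma>) \<and> path_crossings l \<sigma> \<gamma> \<le> lis \<sigma> S"
  using assms
proof (induction "card S" arbitrary: S p rule: less_induct)
  case less
  have fin: "finite S" by (rule finite_subset[OF less.prems(1)]) simp
  show ?case
  proof (cases "S = {}")
    case True
    have "meeting_times l \<sigma> (linepath p p) = {}" "path_image (linepath p p) \<subseteq> strip"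
      using path_within_sector[OF less.prems(2,2)] by auto
    then show ?thesis using less.prems True
      by (intro exI[of _ "linepath p p"]) (simp add: path_crossings_def)
  next
    case False
    let ?A = "rightmost \<sigma> S"
    have A: "?A \<subseteq> S" by (auto simp: rightmost_def)
    have "?A \<noteq> {}" by (rule rightmost_cases[OF less.prems(1) False]) simp_all
    then have "S - ?A \<subset> S" using A by blast
    then have smaller: "card (S - ?A) < card S" by (rule psubset_card_mono[OF fin])
    obtain c where c: "c \<in> strip"
      "\<And>i. i \<in> S - ?A \<Longrightarrow> strand_x \<sigma> i (snd c) < fst c"
      "\<And>i. i \<in> ?A \<Longrightarrow> strand_x \<sigma> i (snd c) = fst c"
      "\<And>i. i \<in> {1..l} - S \<Longrightarrow> fst c < strand_x \<sigma> i (snd c)"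
      using rightmost_exit_point[OF less.prems(1) False less.prems(2)] by blast
    obtain e where e: "0 < e" "c + (e, 0) \<in> sector l \<sigma> S" "c - (e, 0) \<in> sector l \<sigma> (S - ?A)"
      "\<And>i. i \<in> {1..l} \<Longrightarrow> strand_x \<sigma> i (snd c) \<noteq> fst c \<Longrightarrow> e < \<bar>strand_x \<sigma> i (snd c) - fst c\<bar>"
      using sector_clear_radius[OF c(1) less.prems(1) c(2-4) A] by blast
    let ?q = "c + (e, 0)" and ?r = "c - (e, 0)"
    let ?f = "linepath p ?q" and ?g = "linepath ?q ?r"
    obtain h where h: "path h" "path_image h \<subseteq> strip" "pathstart h = ?r"
      "pathfinish h \<in> sector l \<sigma> {}" "finite (meeting_times l \<sigma> h)"
      "path_crossings l \<sigma> h \<le> lis \<sigma> (S - ?A)"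
      using less.hyps[OF smaller _ e(3)] less.prems(1) by blast
    note f = path_within_sector[OF less.prems(2) e(2)]
    note g = path_crossings_horizontal_le_1[where l = l and \<sigma> = \<sigma>, OF c(1) e(1,4)]
    have off: "p \<notin> strands l \<sigma>" "?q \<notin> strands l \<sigma>" "?r \<notin> strands l \<sigma>"
        "pathfinish h \<notin> strands l \<sigma>"
      using less.prems(2) e(2,3) h(4) sector_subset by blast+
    have gh: "finite (meeting_times l \<sigma> (?g +++ h))"
        "path_crossings l \<sigma> (?g +++ h) = path_crossings l \<sigma> ?g + path_crossings l \<sigma> h"
      using path_crossings_join[of ?g h l \<sigma>] off g(2) h(3,5) by simp_all
    have fgh: "finite (meeting_times l \<sigma> (?f +++ (?g +++ h)))"
        "path_crossings l \<sigma> (?f +++ (?g +++ h)) =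
         path_crossings l \<sigma> ?f + path_crossings l \<sigma> (?g +++ h)"
      using path_crossings_join[of ?f "?g +++ h" l \<sigma>] off gh(1) f(2) by simp_all
    have "path_crossings l \<sigma> ?f = 0" using f(2) by (simp add: path_crossings_def)
    then have "path_crossings l \<sigma> (?f +++ (?g +++ h)) \<le> lis \<sigma> S"
      using fgh(2) gh(2) g(3) h(6) lis_remove_rightmost[OF fin False, of \<sigma>] by simp
    moreover have "path (?f +++ (?g +++ h))" using h by simp
    moreover have "path_image (?f +++ (?g +++ h)) \<subseteq> strip"
      by (intro subset_path_image_join f(1) g(1) h(2))
    ultimately show ?thesis using fgh(1) h(4) by (intro exI[of _ "?f +++ (?g +++ h)"]) simp
  qed
qed

lemma path_depth_sector:
  assumes "S \<subseteq> {1..l}" "sector l \<sigma> S \<noteq> {}"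
  shows "path_depth l \<sigma> (sector l \<sigma> S) = lis \<sigma> S"
  unfolding path_depth_def
proof (rule Least_equality)
  obtain p where p: "p \<in> sector l \<sigma> S" using assms(2) by blast
  obtain \<gamma> where \<gamma>: "path \<gamma>" "path_image \<gamma> \<subseteq> strip" "pathstart \<gamma> = p"
      "pathfinish \<gamma> \<in> sector l \<sigma> {}" "finite (meeting_times l \<sigma> \<gamma>)" "path_crossings l \<sigma> \<gamma> \<le> lis \<sigma> S"
    using escape_within_lis[OF assms(1) p] by blast
  then have esc: "escape_path l \<sigma> (sector l \<sigma> S) \<gamma>"
    using p face_infinity_eq by (simp add: escape_path_def)
  then have "path_crossings l \<sigma> \<gamma> = lis \<sigma> S"
    using lis_le_path_crossings[OF esc assms(1)] \<gamma>(6) by simp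
  then show "\<exists>\<gamma>. escape_path l \<sigma> (sector l \<sigma> S) \<gamma> \<and> path_crossings l \<sigma> \<gamma> = lis \<sigma> S" using esc by blast
next
  fix n assume "\<exists>\<gamma>. escape_path l \<sigma> (sector l \<sigma> S) \<gamma> \<and> path_crossings l \<sigma> \<gamma> = n"
  then show "lis \<sigma> S \<le> n" using lis_le_path_crossings assms(1) by blast
qed

text \<open>The description of the face is the one shared by \<^const>\<open>face_left\<close> and \<^const>\<open>face_right\<close>.\<close>

lemma path_depth_beside:
  assumes "S \<subseteq> {1..l}"
    and "\<And>s. 0 < s \<Longrightarrow> s < 1 \<Longrightarrow> 0 \<le> snd (q s) \<and> snd (q s) \<le> 1 \<and> q s \<in> separated l \<sigma> S"
  shows "path_depth l \<sigma> (THE F. F \<in> faces l \<sigma> \<and>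
    (\<exists>e>0. \<forall>s::real. 0 < s \<and> s < e \<longrightarrow> q s \<in> closure F)) = lis \<sigma> S"
  using the_face_near[OF assms] path_depth_sector[OF assms(1)] by simp

lemma depth_diff_top:
  assumes "i \<in> {1..l}"
  shows "depth_diff l \<sigma> (top_vertex i) = prefix_growth \<sigma> i"
proof -
  have "path_depth l \<sigma> (face_left l \<sigma> (top_vertex i)) = lis \<sigma> {1..<i}"
    unfolding face_left_def
    by (rule path_depth_beside) (use assms in \<open>auto simp: top_vertex_def separated_def strand_x_def\<close>)
  moreover have "path_depth l \<sigma> (face_right l \<sigma> (top_vertex i)) = lis \<sigma> {1..i}"
    unfolding face_right_def
    by (rule path_depth_beside) (use assms in \<open>auto simp: top_vertex_def separated_def strand_x_def\<close>)
  ultimately show ?thesis by (simp add: depth_diff_def prefix_growth_def)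
qed

lemma depth_diff_bottom:
  "depth_diff l \<sigma> (bottom_vertex v) = value_growth l \<sigma> v"
proof -
  have "path_depth l \<sigma> (face_left l \<sigma> (bottom_vertex v)) = lis \<sigma> {j \<in> {1..l}. \<sigma> j < v}"
    unfolding face_left_def
    by (rule path_depth_beside) (auto simp: bottom_vertex_def separated_def strand_x_def)
  moreover have "path_depth l \<sigma> (face_right l \<sigma> (bottom_vertex v)) = lis \<sigma> {j \<in> {1..l}. \<sigma> j \<le> v}"
    unfolding face_right_def
    by (rule path_depth_beside) (auto simp: bottom_vertex_def separated_def strand_x_def)
  ultimately show ?thesis by (simp add: depth_diff_def value_growth_def)
qed

end

theorem theorem5p6:
  fixes l :: nat and \<sigma> :: "nat \<Rightarrow> nat" and S_plus S_minus R Q :: tableau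
  assumes "\<sigma> permutes {1..l}"
    and "avoids_321 l \<sigma>"
    and "Psi l \<sigma> = (S_plus, S_minus)"
    and "robinson_schensted l \<sigma> = (R, Q)"
  shows "S_plus = R \<and> S_minus = Q"
proof -
  interpret avoiding_permutation l \<sigma> using assms(1,2) by unfold_locales
  have "two_row_tableau l \<delta> = two_row_tableau l \<delta>'" if "\<And>i. i \<in> {1..l} \<Longrightarrow> \<delta> i = \<delta>' i" for \<delta> \<delta>'
  proof -
    have "filter (\<lambda>i. \<delta> i = k) [1..<Suc l] = filter (\<lambda>i. \<delta>' i = k) [1..<Suc l]" for k
      by (rule filter_cong) (use that in auto)
    then show ?thesis by (simp only: two_row_tableau_def)
  qed
  note cong = this
  have "two_row_tableau l (\<lambda>i. depth_diff l \<sigma> (top_vertex i)) = two_row_tableau l (prefix_growth \<sigma>)"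
    by (rule cong) (rule depth_diff_top)
  moreover have "two_row_tableau l (\<lambda>i. depth_diff l \<sigma> (bottom_vertex i)) =
      two_row_tableau l (value_growth l \<sigma>)"
    by (rule cong) (rule depth_diff_bottom)
  ultimately have "Psi l \<sigma> = robinson_schensted l \<sigma>"
    unfolding Psi_def robinson_schensted_growth by (simp only:)
  then show ?thesis using assms(3,4) by simp
qed

end
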